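(* Consider the kl-UCB-4P algorithm with constant $c>0$. (i) For any non-profitable arm $a$ (i.e. $\mu_a<\tau_a$) and every $\epsilon\in(0,1)$, there exist positive quantities $H_1(\epsilon)$ and $\beta_1(\epsilon)$, depending only on $\epsilon,c_a^-,\mu_a,\tau_a$, such that for all $T$, $$\mathbb{E}[N_a(T)]\le (1+\epsilon)\frac{\tilde c_a^+(\log T+c\log\log T)}{c_a^-\,d(\mu_a,\tau_a)}+\tilde c_a^+\Big\{1+\frac{H_1(\epsilon)}{T^{\beta_1(\epsilon)}}\Big\}.$$ (ii) For any profitable arm $a$ (i.e. $\mu_a>\tau_a$), if $T\ge\max(3,c_a^+)$ and $c\ge 3$, then $$\tilde C_a(T)-\mathbb{E}[N_a(T)]\le \tilde c_a^+\{e(2c+3)\log\log T+c_a^++3\}.$$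
   Context: Profitable bandit setting: $K\ge 2$ arms; arm $a$ has reward distribution $\nu_a$ with mean $\mu_a$ and known threshold $\tau_a$. At each round $t\in\{1,\dots,T\}$, $C_a(t)$ clients of category $a$ arrive with $1\le c_a^-\le C_a(t)\le c_a^+<\infty$; the agent chooses $A_t\subseteq\{1,\dots,K\}$ and for each $a\in A_t$ observes $C_a(t)$ and rewards $X_{a,c,t}$, $1\le c\le C_a(t)$, i.i.d. $\sim\nu_a$; for each arm all variables $\{C_a(t),X_{a,c,t}\}$ are independent. $\tilde c_a^+\in[c_a^-,c_a^+]$ is an upper bound on $\mathbb{E}[C_a(t)]$ for all $t\le T$. $N_a(t)=\sum_{s=1}^t C_a(s)\mathbb{I}\{a\in A_s\}$, $\tilde C_a(T)=\mathbb{E}[\sum_{t=1}^T C_a(t)]$, and $\hat\mu_a(t)$ is the average of the $N_a(t)$ rewards observed from arm $a$ up to round $t$. Exponential family: all $\nu_a$ belong to a known one-dimensional canonical exponential family $\{\nu_\theta:\theta\in\Theta\}$, $\Theta$ an open interval, with densities $f_\theta(x)=A(x)\exp(x\theta-F(\theta))$ w.r.t. a reference measure, $F$ twice continuously differentiable, so $\theta\mapsto\mu(\theta)=\mathbb{E}_\theta[X]$ is strictly increasing. For means $x,y$, $d(x,y)=\mathrm{KL}(\nu_{\mu^{-1}(x)},\nu_{\mu^{-1}(y)})=F(\theta')-F(\theta)-F'(\theta)(\theta'-\theta)$ with $\theta=\mu^{-1}(x)$, $\theta'=\mu^{-1}(y)$. Index policy: $A_1=\{1,\dots,K\}$ and,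 for $t\ge1$, $A_{t+1}=\{a: u_a(t)\ge\tau_a\}$. kl-UCB-4P uses the index $u_a(t)=\sup\{q>\hat\mu_a(t): N_a(t)\,d(\hat\mu_a(t),q)\le\log t+c\log\log t\}$.
   Formalization: Part (i) is proved for T ≥ 3: log log T is undefined at T = 1, and at T = 2 the bound fails for large c as H_1 may not depend on c. τ_a is assumed to be a mean of the family in (i), and H_1, β_1 are chosen for sample spaces on one fixed underlying set (enough by passing to the joint law). *)

theory Defs
  imports "HOL-Probability.Probability"
begin

definition expfam_nu :: "real measure \<Rightarrow> (real \<Rightarrow> real) \<Rightarrow> (real \<Rightarrow> real) \<Rightarrow> real \<Rightarrow> real measure" where
  "expfam_nu \<rho> Af F \<theta> = density \<rho> (\<lambda>x. ennreal (Af x * exp (x * \<theta> - F \<theta>)))"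

definition expfam_mean :: "real measure \<Rightarrow> (real \<Rightarrow> real) \<Rightarrow> (real \<Rightarrow> real) \<Rightarrow> real \<Rightarrow> real" where
  "expfam_mean \<rho> Af F \<theta> = (\<integral>x. x \<partial>(expfam_nu \<rho> Af F \<theta>))"

definition expfam :: "real set \<Rightarrow> real measure \<Rightarrow> (real \<Rightarrow> real) \<Rightarrow> (real \<Rightarrow> real) \<Rightarrow> bool" where
  "expfam \<Theta> \<rho> Af F \<longleftrightarrow>
     open \<Theta> \<and> is_interval \<Theta> \<and> \<Theta> \<noteq> {} \<and>
     sets \<rho> = sets borel \<and> Af \<in> borel_measurable \<rho> \<and> (\<forall>x. 0 \<le> Af x) \<and>
     (\<exists>F' F''. (\<forall>\<theta>\<in>\<Theta>. (F has_real_derivative F' \<theta>) (at \<theta>) \<and>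
                           (F' has_real_derivative F'' \<theta>) (at \<theta>)) \<and> continuous_on \<Theta> F'') \<and>
     (\<forall>\<theta>\<in>\<Theta>. prob_space (expfam_nu \<rho> Af F \<theta>) \<and> integrable (expfam_nu \<rho> Af F \<theta>) (\<lambda>x. x)) \<and>
     strict_mono_on \<Theta> (expfam_mean \<rho> Af F)"

definition expfam_theta :: "real set \<Rightarrow> real measure \<Rightarrow> (real \<Rightarrow> real) \<Rightarrow> (real \<Rightarrow> real) \<Rightarrow> real \<Rightarrow> real" where
  "expfam_theta \<Theta> \<rho> Af F x = the_inv_into \<Theta> (expfam_mean \<rho> Af F) x"

definition expfam_kl :: "real set \<Rightarrow> real measure \<Rightarrow> (real \<Rightarrow> real) \<Rightarrow> (real \<Rightarrow> real) \<Rightarrow> real \<Rightarrow> real \<Rightarrow> real" where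
  "expfam_kl \<Theta> \<rho> Af F x y =
     (let \<theta> = expfam_theta \<Theta> \<rho> Af F x; \<theta>' = expfam_theta \<Theta> \<rho> Af F y
      in F \<theta>' - F \<theta> - deriv F \<theta> * (\<theta>' - \<theta>))"

text \<open>d used inside the index: equal to expfam_kl when x is a mean of the family; for an
  empirical mean x outside mu(Theta) (boundary of the mean range) it is the usual extension
  sup_theta (x theta - F theta) - (x theta' - F theta'), possibly infinite.\<close>
definition expfam_kl_ext :: "real set \<Rightarrow> real measure \<Rightarrow> (real \<Rightarrow> real) \<Rightarrow> (real \<Rightarrow> real) \<Rightarrow> real \<Rightarrow> real \<Rightarrow> ereal" where
  "expfam_kl_ext \<Theta> \<rho> Af F x y =
     (if x \<in> expfam_mean \<rho> Af F ` \<Theta> then ereal (expfam_kl \<Theta> \<rho> Af F x y)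
      else (let \<theta>' = expfam_theta \<Theta> \<rho> Af F y
            in (SUP \<theta>\<in>\<Theta>. ereal (x * \<theta> - F \<theta>)) - ereal (x * \<theta>' - F \<theta>')))"

text \<open>u = sup{q > m : n d(m,q) \<le> log t + c log log t}, with the convention that the supremum
  is m when the set is empty (q ranges over the means of the family).\<close>
definition klucb4p_index :: "real set \<Rightarrow> real measure \<Rightarrow> (real \<Rightarrow> real) \<Rightarrow> (real \<Rightarrow> real) \<Rightarrow>
     real \<Rightarrow> nat \<Rightarrow> nat \<Rightarrow> real \<Rightarrow> ereal" where
  "klucb4p_index \<Theta> \<rho> Af F c t n m =
     Sup ({ereal m} \<union>
          {ereal q | q. q \<in> expfam_mean \<rho> Af F ` \<Theta> \<and> m < q \<and>
             ereal (real n) * expfam_kl_ext \<Theta> \<rho> Af F m q \<le> ereal (ln (real t) + c * ln (ln (real t)))})"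

text \<open>A history H is the list [A_1, ..., A_t] of chosen arm sets. C a s w is C_a(s),
  X a c s w is X_{a,c,s}.\<close>
definition hist_N :: "(nat \<Rightarrow> nat \<Rightarrow> 'w \<Rightarrow> nat) \<Rightarrow> nat set list \<Rightarrow> nat \<Rightarrow> 'w \<Rightarrow> nat" where
  "hist_N C H a \<omega> = (\<Sum>s<length H. if a \<in> H ! s then C a (Suc s) \<omega> else 0)"

definition hist_S :: "(nat \<Rightarrow> nat \<Rightarrow> 'w \<Rightarrow> nat) \<Rightarrow> (nat \<Rightarrow> nat \<Rightarrow> nat \<Rightarrow> 'w \<Rightarrow> real) \<Rightarrow>
    nat set list \<Rightarrow> nat \<Rightarrow> 'w \<Rightarrow> real" where
  "hist_S C X H a \<omega> =
     (\<Sum>s<length H. if a \<in> H ! s then (\<Sum>c\<in>{1..C a (Suc s) \<omega>}. X a c (Suc s) \<omega>) else 0)"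

definition hist_muhat :: "(nat \<Rightarrow> nat \<Rightarrow> 'w \<Rightarrow> nat) \<Rightarrow> (nat \<Rightarrow> nat \<Rightarrow> nat \<Rightarrow> 'w \<Rightarrow> real) \<Rightarrow>
    nat set list \<Rightarrow> nat \<Rightarrow> 'w \<Rightarrow> real" where
  "hist_muhat C X H a \<omega> =
     (if hist_N C H a \<omega> = 0 then 0 else hist_S C X H a \<omega> / real (hist_N C H a \<omega>))"

primrec index_policy_hist :: "nat \<Rightarrow> (nat \<Rightarrow> nat \<Rightarrow> nat set list \<Rightarrow> 'w \<Rightarrow> ereal) \<Rightarrow> (nat \<Rightarrow> real) \<Rightarrow>
    nat \<Rightarrow> 'w \<Rightarrow> nat set list" where
  "index_policy_hist K u tau 0 \<omega> = []"
| "index_policy_hist K u tau (Suc t) \<omega> =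
     (let H = index_policy_hist K u tau t \<omega>
      in H @ [if t = 0 then {..<K} else {a. a < K \<and> ereal (tau a) \<le> u a t H \<omega>}])"

text \<open>A_t for t \<ge> 1.\<close>
definition index_policy_A :: "nat \<Rightarrow> (nat \<Rightarrow> nat \<Rightarrow> nat set list \<Rightarrow> 'w \<Rightarrow> ereal) \<Rightarrow> (nat \<Rightarrow> real) \<Rightarrow>
    nat \<Rightarrow> 'w \<Rightarrow> nat set" where
  "index_policy_A K u tau t \<omega> = index_policy_hist K u tau t \<omega> ! (t - 1)"

definition klucb4p_u :: "real set \<Rightarrow> real measure \<Rightarrow> (real \<Rightarrow> real) \<Rightarrow> (real \<Rightarrow> real) \<Rightarrow> real \<Rightarrow>
    (nat \<Rightarrow> nat \<Rightarrow> 'w \<Rightarrow> nat) \<Rightarrow> (nat \<Rightarrow> nat \<Rightarrow> nat \<Rightarrow> 'w \<Rightarrow> real) \<Rightarrow>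
    nat \<Rightarrow> nat \<Rightarrow> nat set list \<Rightarrow> 'w \<Rightarrow> ereal" where
  "klucb4p_u \<Theta> \<rho> Af F c C X a t H \<omega> =
     klucb4p_index \<Theta> \<rho> Af F c t (hist_N C H a \<omega>) (hist_muhat C X H a \<omega>)"

definition klucb4p_A :: "real set \<Rightarrow> real measure \<Rightarrow> (real \<Rightarrow> real) \<Rightarrow> (real \<Rightarrow> real) \<Rightarrow> real \<Rightarrow>
    nat \<Rightarrow> (nat \<Rightarrow> real) \<Rightarrow> (nat \<Rightarrow> nat \<Rightarrow> 'w \<Rightarrow> nat) \<Rightarrow> (nat \<Rightarrow> nat \<Rightarrow> nat \<Rightarrow> 'w \<Rightarrow> real) \<Rightarrow>
    nat \<Rightarrow> 'w \<Rightarrow> nat set" where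
  "klucb4p_A \<Theta> \<rho> Af F c K tau C X = index_policy_A K (klucb4p_u \<Theta> \<rho> Af F c C X) tau"

definition pulls_N :: "(nat \<Rightarrow> nat \<Rightarrow> 'w \<Rightarrow> nat) \<Rightarrow> (nat \<Rightarrow> 'w \<Rightarrow> nat set) \<Rightarrow> nat \<Rightarrow> nat \<Rightarrow> 'w \<Rightarrow> nat" where
  "pulls_N C A a T \<omega> = (\<Sum>t\<in>{1..T}. if a \<in> A t \<omega> then C a t \<omega> else 0)"

definition bandit_model ::
  "'w measure \<Rightarrow> real set \<Rightarrow> real measure \<Rightarrow> (real \<Rightarrow> real) \<Rightarrow> (real \<Rightarrow> real) \<Rightarrow>
   nat \<Rightarrow> (nat \<Rightarrow> real) \<Rightarrow> (nat \<Rightarrow> nat) \<Rightarrow> (nat \<Rightarrow> nat) \<Rightarrow> (nat \<Rightarrow> real) \<Rightarrow>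
   (nat \<Rightarrow> nat \<Rightarrow> 'w \<Rightarrow> nat) \<Rightarrow> (nat \<Rightarrow> nat \<Rightarrow> nat \<Rightarrow> 'w \<Rightarrow> real) \<Rightarrow> nat \<Rightarrow> bool" where
  "bandit_model M \<Theta> \<rho> Af F K th cm cp ctil C X T \<longleftrightarrow>
     prob_space M \<and> 2 \<le> K \<and>
     (\<forall>a<K. th a \<in> \<Theta> \<and> 1 \<le> cm a \<and> cm a \<le> cp a \<and> real (cm a) \<le> ctil a \<and> ctil a \<le> real (cp a)) \<and>
     (\<forall>a<K. \<forall>t\<ge>1. C a t \<in> measurable M (count_space UNIV) \<and>
                   (\<forall>\<omega>\<in>space M. cm a \<le> C a t \<omega> \<and> C a t \<omega> \<le> cp a)) \<and>
     (\<forall>a<K. \<forall>t\<in>{1..T}. (\<integral>\<omega>. real (C a t \<omega>) \<partial>M) \<le> ctil a) \<and>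
     (\<forall>a<K. \<forall>c\<ge>1. \<forall>t\<ge>1. X a c t \<in> borel_measurable M \<and>
                          distr M borel (X a c t) = expfam_nu \<rho> Af F (th a)) \<and>
     (\<forall>a<K. prob_space.indep_vars M (\<lambda>_. borel)
        (\<lambda>i. case i of Inl t \<Rightarrow> (\<lambda>\<omega>. real (C a t \<omega>)) | Inr (c, t) \<Rightarrow> X a c t)
        ({Inl t | t. 1 \<le> t} \<union> {Inr (c, t) | c t. 1 \<le> c \<and> 1 \<le> t}))"

end

theory Submission
  imports Defs
begin

text \<open>
  Whether arm \<open>a\<close> is played depends only on the past of arm \<open>a\<close>, so each arm can be studied alone.
  By independence of the current round from the past,
  \<open>exp ((\<theta>' - \<theta>) * S - N * (F \<theta>' - F \<theta>))\<close> has expectation 1 at every time and under every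
  predictable policy, where \<open>N\<close> is the number of clients served and \<open>S\<close> their total reward.

  Unprofitable arm: once more than \<open>(1 + \<epsilon>) * (log T + c log log T) / (c\<^sup>- d(\<mu>, \<tau>))\<close> rounds have been
  played, playing again forces the empirical mean above a fixed level strictly between \<open>\<mu>\<close> and \<open>\<tau>\<close>,
  and by Markov's inequality these events have geometrically decreasing probabilities.

  Profitable arm: not playing forces \<open>N * d(S / N, \<mu>) > log t + c log log t\<close> with \<open>S / N < \<mu>\<close>; peeling over
  geometric slices of \<open>N\<close> bounds the probability of this by a multiple of \<open>1 / (t log t)\<close>, whose
  sum is of order \<open>log log T\<close>.
\<close>

section \<open>One-dimensional exponential families\<close>

text \<open>Two obstacles shape the development. The index is a supremum over uncountably many
  means, and the empirical mean fed into it may lie outside the range of \<open>mean\<close>.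
  Writing the divergence as a Fenchel conjugate settles the second point: the index constraint
  becomes a family of inequalities affine in the empirical mean, and each of them is the logarithm
  of a likelihood ratio. Monotonicity in the empirical mean settles the first: it makes the decision
  measurable, and it turns a deviation witnessed by some unknown parameter into a half-line event,
  to which a single likelihood ratio applies. Independence is assumed only among the variables of
  one arm, and group sizes are random. The likelihood ratio therefore counts clients rather than
  rounds, and nothing about the joint law of different arms may enter.\<close>

locale exp_family =
  fixes \<Theta> :: "real set" and \<rho> :: "real measure" and Af F :: "real \<Rightarrow> real"
  assumes expfam: "expfam \<Theta> \<rho> Af F"
begin

abbreviation "nu \<equiv> expfam_nu \<rho> Af F"
abbreviation "mean \<equiv> expfam_mean \<rho> Af F"

text \<open>The Bregman divergence of \<open>F\<close>, that is \<open>d\<close> in natural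
  parameters. Having \<open>mean\<close> in place of the derivative of \<open>F\<close> lets the
  support line inequality apply directly.\<close>

definition kl_param :: "real \<Rightarrow> real \<Rightarrow> real" where
  "kl_param \<theta> \<theta>' = F \<theta>' - F \<theta> - mean \<theta> * (\<theta>' - \<theta>)"

lemma sets_nu [simp]: "sets (nu \<theta>) = sets borel"
  using expfam by (simp add: expfam_def expfam_nu_def)

lemma space_nu [simp]: "space (nu \<theta>) = UNIV"
  using sets_eq_imp_space_eq[OF sets_nu, of \<theta>] by simp

lemma Af_measurable [measurable]: "Af \<in> borel_measurable borel"
  using expfam measurable_cong_sets[of \<rho> borel borel borel] by (auto simp: expfam_def)

lemma prob_space_nu: "\<theta> \<in> \<Theta> \<Longrightarrow> prob_space (nu \<theta>)"
  and integrable_nu: "\<theta> \<in> \<Theta> \<Longrightarrow> integrable (nu \<theta>) (\<lambda>x. x)"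
  using expfam by (auto simp: expfam_def)

lemma mean_strict_mono: "strict_mono_on \<Theta> mean"
  using expfam by (simp add: expfam_def)

lemma mean_less_iff: "\<theta> \<in> \<Theta> \<Longrightarrow> \<theta>' \<in> \<Theta> \<Longrightarrow> mean \<theta> < mean \<theta>' \<longleftrightarrow> \<theta> < \<theta>'"
  using mean_strict_mono by (metis strict_mono_on_less)

lemma theta_mean: "\<theta> \<in> \<Theta> \<Longrightarrow> expfam_theta \<Theta> \<rho> Af F (mean \<theta>) = \<theta>"
  unfolding expfam_theta_def
  by (rule the_inv_into_f_f) (auto intro: strict_mono_on_imp_inj_on mean_strict_mono)

text \<open>Multiplying the density of \<open>nu \<theta>\<close> by this factor gives the density
  of \<open>nu \<theta>'\<close>, which has mass 1. All later estimates use the exponential form of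
  the densities only through this identity.\<close>

lemma nn_integral_tilt:
  assumes "\<theta> \<in> \<Theta>" "\<theta>' \<in> \<Theta>"
  shows "(\<integral>\<^sup>+x. ennreal (exp ((\<theta>' - \<theta>) * x - (F \<theta>' - F \<theta>))) \<partial>nu \<theta>) = 1"
proof -
  have sr: "sets \<rho> = sets borel" and Ap: "\<And>x. 0 \<le> Af x" using expfam by (auto simp: expfam_def)
  note [measurable_cong] = sr
  have "(\<integral>\<^sup>+x. ennreal (exp ((\<theta>' - \<theta>) * x - (F \<theta>' - F \<theta>))) \<partial>nu \<theta>)
    = (\<integral>\<^sup>+x. ennreal (Af x * exp (x * \<theta> - F \<theta>)) * ennreal (exp ((\<theta>' - \<theta>) * x - (F \<theta>' - F \<theta>))) \<partial>\<rho>)"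
    unfolding expfam_nu_def by (subst nn_integral_density) auto
  also have "\<dots> = (\<integral>\<^sup>+x. ennreal (Af x * exp (x * \<theta>' - F \<theta>')) * indicator (space \<rho>) x \<partial>\<rho>)"
  proof (intro nn_integral_cong)
    fix x assume "x \<in> space \<rho>"
    have "exp (x * \<theta> - F \<theta>) * exp ((\<theta>' - \<theta>) * x - (F \<theta>' - F \<theta>)) = exp (x * \<theta>' - F \<theta>')"
      unfolding exp_add[symmetric] by (rule arg_cong[of _ _ exp]) (simp add: algebra_simps)
    then show "ennreal (Af x * exp (x * \<theta> - F \<theta>)) * ennreal (exp ((\<theta>' - \<theta>) * x - (F \<theta>' - F \<theta>)))
      = ennreal (Af x * exp (x * \<theta>' - F \<theta>')) * indicator (space \<rho>) x"
      using \<open>x \<in> space \<rho>\<close> Ap[of x] by (simp add: ennreal_mult'[symmetric] mult.assoc)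
  qed
  also have "\<dots> = emeasure (nu \<theta>') (space \<rho>)"
    unfolding expfam_nu_def by (subst emeasure_density) auto
  also have "space \<rho> = space (nu \<theta>')" by (simp add: expfam_nu_def)
  also have "emeasure (nu \<theta>') (space (nu \<theta>')) = 1"
    by (rule prob_space.emeasure_space_1[OF prob_space_nu[OF assms(2)]])
  finally show ?thesis .
qed

lemma
  assumes "\<theta> \<in> \<Theta>" "\<theta>' \<in> \<Theta>"
  shows integrable_tilt: "integrable (nu \<theta>) (\<lambda>x. exp ((\<theta>' - \<theta>) * x - (F \<theta>' - F \<theta>)))"
    and integral_tilt: "(\<integral>x. exp ((\<theta>' - \<theta>) * x - (F \<theta>' - F \<theta>)) \<partial>nu \<theta>) = 1"
proof -
  have m: "(\<lambda>x. exp ((\<theta>' - \<theta>) * x - (F \<theta>' - F \<theta>))) \<in> borel_measurable (nu \<theta>)"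
    by (simp add: measurable_cong_sets[OF sets_nu refl])
  show "integrable (nu \<theta>) (\<lambda>x. exp ((\<theta>' - \<theta>) * x - (F \<theta>' - F \<theta>)))"
    using nn_integral_tilt[OF assms] m by (intro integrableI_nonneg) auto
  show "(\<integral>x. exp ((\<theta>' - \<theta>) * x - (F \<theta>' - F \<theta>)) \<partial>nu \<theta>) = 1"
    using nn_integral_tilt[OF assms] m by (subst integral_eq_nn_integral) auto
qed

text \<open>This identifies the mean with the derivative of \<open>F\<close> without differentiating under the integral.\<close>
lemma support_line:
  assumes "\<theta> \<in> \<Theta>" "\<theta>' \<in> \<Theta>"
  shows "mean \<theta> * (\<theta>' - \<theta>) \<le> F \<theta>' - F \<theta>"
proof -
  interpret prob_space "nu \<theta>" by (rule prob_space_nu[OF assms(1)])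
  \<comment> \<open>Jensen's inequality in its simplest form: \<open>1 + x \<le> exp x\<close>,
    integrated against a tilt of mass 1.\<close>
  have "(\<integral>x. 1 + ((\<theta>' - \<theta>) * x - (F \<theta>' - F \<theta>)) \<partial>nu \<theta>)
      \<le> (\<integral>x. exp ((\<theta>' - \<theta>) * x - (F \<theta>' - F \<theta>)) \<partial>nu \<theta>)"
    using integrable_nu[OF assms(1)]
    by (intro integral_mono integrable_tilt[OF assms] exp_ge_add_one_self) auto
  also have "\<dots> = 1" by (rule integral_tilt[OF assms])
  finally show ?thesis
    using integrable_nu[OF assms(1)] prob_space by (simp add: expfam_mean_def mult.commute)
qed

text \<open>By the support line, \<open>F t - mean \<theta> * t\<close> has a local minimum at
  \<theta>, so its derivative vanishes there.\<close>

lemma mean_deriv: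
  assumes "\<theta> \<in> \<Theta>"
  shows "(F has_real_derivative mean \<theta>) (at \<theta>)"
proof -
  obtain F' where F': "(F has_real_derivative F') (at \<theta>)"
    using expfam assms unfolding expfam_def by blast
  have "open \<Theta>" using expfam by (simp add: expfam_def)
  then obtain e where "e > 0" "ball \<theta> e \<subseteq> \<Theta>"
    using assms open_contains_ball by blast
  then have e: "e > 0" "\<And>y. \<bar>\<theta> - y\<bar> < e \<Longrightarrow> y \<in> \<Theta>"
    by (auto simp: subset_eq dist_real_def)
  have "((\<lambda>t. F t - mean \<theta> * t) has_real_derivative F' - mean \<theta>) (at \<theta>)"
    using F' by (auto intro!: derivative_eq_intros)
  moreover have "\<forall>y. \<bar>\<theta> - y\<bar> < e \<longrightarrow> F \<theta> - mean \<theta> * \<theta> \<le> F y - mean \<theta> * y"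
    using support_line[OF assms e(2)] by (auto simp: algebra_simps)
  ultimately have "F' - mean \<theta> = 0" by (rule DERIV_local_min[OF _ e(1)])
  with F' show ?thesis by simp
qed

text \<open>Smoothness is assumed of \<open>F\<close> only; on the open set \<Theta> the mean
  coincides with the differentiable function \<open>F'\<close>, and continuity carries over.\<close>

lemma isCont_mean:
  assumes "\<theta> \<in> \<Theta>"
  shows "isCont mean \<theta>"
proof -
  obtain F' F'' where d: "\<And>\<theta>. \<theta> \<in> \<Theta> \<Longrightarrow> (F has_real_derivative F' \<theta>) (at \<theta>) \<and> (F' has_real_derivative F'' \<theta>) (at \<theta>)"
    and op: "open \<Theta>"
    using expfam unfolding expfam_def by blast
  have "isCont F' \<theta>" using d[OF assms] DERIV_isCont by blast
  moreover have "\<forall>\<^sub>F x in nhds \<theta>. F' x = mean x"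
    using eventually_nhds_in_open[OF op assms] 
    by eventually_elim (metis d mean_deriv DERIV_unique)
  ultimately show ?thesis using isCont_cong by blast
qed

lemma kl_mean:
  assumes "\<theta> \<in> \<Theta>" "\<theta>' \<in> \<Theta>"
  shows "expfam_kl \<Theta> \<rho> Af F (mean \<theta>) (mean \<theta>') = kl_param \<theta> \<theta>'"
  using assms DERIV_imp_deriv[OF mean_deriv[OF assms(1)]]
  by (simp add: expfam_kl_def theta_mean kl_param_def)

lemma kl_param_mono:
  assumes "\<theta> \<in> \<Theta>" "\<theta>' \<in> \<Theta>" "\<theta>'' \<in> \<Theta>" "\<theta> \<le> \<theta>'" "\<theta>' \<le> \<theta>''"
  shows "kl_param \<theta> \<theta>' \<le> kl_param \<theta> \<theta>''"
proof -
  have "mean \<theta> \<le> mean \<theta>'"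
    using assms mean_less_iff[of \<theta>' \<theta>] by linarith
  then have "mean \<theta> * (\<theta>'' - \<theta>') \<le> mean \<theta>' * (\<theta>'' - \<theta>')"
    using assms by (intro mult_right_mono) auto
  also have "\<dots> \<le> F \<theta>'' - F \<theta>'" by (rule support_line) fact+
  finally show ?thesis by (simp add: kl_param_def algebra_simps)
qed

lemma interval_mem:
  assumes "a \<in> \<Theta>" "b \<in> \<Theta>" "a \<le> x" "x \<le> b"
  shows "x \<in> \<Theta>"
  using expfam assms unfolding expfam_def is_interval_1 by blast

text \<open>Support lines at \<theta> and at the midpoint \<open>m\<close> leave the surplus
  \<open>(mean m - mean \<theta>) * (\<theta>' - m)\<close>, whose factors have the same sign
  because \<open>mean\<close> is strictly increasing.\<close>

lemma kl_param_pos: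
  assumes "\<theta> \<in> \<Theta>" "\<theta>' \<in> \<Theta>" "\<theta> \<noteq> \<theta>'"
  shows "0 < kl_param \<theta> \<theta>'"
proof -
  define m where "m = (\<theta> + \<theta>') / 2"
  have m: "m \<in> \<Theta>"
    by (rule interval_mem[of "min \<theta> \<theta>'" "max \<theta> \<theta>'"]) (use assms in \<open>auto simp: m_def min_def max_def\<close>)
  have 1: "mean m * (\<theta>' - m) \<le> F \<theta>' - F m" by (rule support_line) fact+
  have 2: "mean \<theta> * (m - \<theta>) \<le> F m - F \<theta>" by (rule support_line) fact+
  have "0 < (mean m - mean \<theta>) * (\<theta>' - m)"
    using assms mean_less_iff[of \<theta> m] mean_less_iff[of m \<theta>] m
    by (cases "\<theta> < \<theta>'") (auto simp: zero_less_mult_iff m_def)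
  with 1 2 show ?thesis by (simp add: kl_param_def algebra_simps)
qed

text \<open>The divergence from \<open>x\<close> is the supremum over \<theta> of
  \<open>x * (\<theta> - \<theta>q) - (F \<theta> - F \<theta>q)\<close>. For \<open>x\<close> in
  the range of \<open>mean\<close> the support line shows that it is attained at the parameter of
  \<open>x\<close>; otherwise the extension is defined by this supremum. The right-hand side no
  longer distinguishes the two cases.\<close>

lemma kl_ext_le_iff:
  assumes q: "\<theta>q \<in> \<Theta>" and n: "n > (0::nat)"
  shows "ereal (real n) * expfam_kl_ext \<Theta> \<rho> Af F x (mean \<theta>q) \<le> ereal b
    \<longleftrightarrow> (\<forall>\<theta>\<in>\<Theta>. real n * (x * (\<theta> - \<theta>q) - (F \<theta> - F \<theta>q)) \<le> b)"
proof -
  have "ereal (real n) * expfam_kl_ext \<Theta> \<rho> Af F x (mean \<theta>q) \<le> ereal b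
    \<longleftrightarrow> expfam_kl_ext \<Theta> \<rho> Af F x (mean \<theta>q) \<le> ereal (b / n)"
    using n by (cases "expfam_kl_ext \<Theta> \<rho> Af F x (mean \<theta>q)") (auto simp: field_simps)
  also have "\<dots> \<longleftrightarrow> (\<forall>\<theta>\<in>\<Theta>. x * (\<theta> - \<theta>q) - (F \<theta> - F \<theta>q) \<le> b / n)"
  proof (cases "x \<in> mean ` \<Theta>")
    case True
    then obtain \<theta>x where x: "\<theta>x \<in> \<Theta>" "x = mean \<theta>x" by auto
    have "x * (\<theta> - \<theta>q) - (F \<theta> - F \<theta>q) \<le> kl_param \<theta>x \<theta>q" if "\<theta> \<in> \<Theta>" for \<theta>
      using support_line[OF x(1) that] x(2) by (simp add: kl_param_def algebra_simps)
    moreover have "x * (\<theta>x - \<theta>q) - (F \<theta>x - F \<theta>q) = kl_param \<theta>x \<theta>q"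
      using x(2) by (simp add: kl_param_def algebra_simps)
    ultimately have "kl_param \<theta>x \<theta>q \<le> b / n \<longleftrightarrow> (\<forall>\<theta>\<in>\<Theta>. x * (\<theta> - \<theta>q) - (F \<theta> - F \<theta>q) \<le> b / n)"
      using x(1) by force
    then show ?thesis using x q by (simp add: expfam_kl_ext_def kl_mean)
  next
    case False
    have "(SUP \<theta>\<in>\<Theta>. ereal (x * \<theta> - F \<theta>)) - ereal (x * \<theta>q - F \<theta>q) \<le> ereal (b / n)
       \<longleftrightarrow> (SUP \<theta>\<in>\<Theta>. ereal (x * \<theta> - F \<theta>)) \<le> ereal (b / n + (x * \<theta>q - F \<theta>q))"
      by (cases "SUP \<theta>\<in>\<Theta>. ereal (x * \<theta> - F \<theta>)") auto
    also have "\<dots> \<longleftrightarrow> (\<forall>\<theta>\<in>\<Theta>. x * \<theta> - F \<theta> \<le> b / n + (x * \<theta>q - F \<theta>q))"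
      by (simp add: SUP_le_iff)
    finally show ?thesis using False q
      by (simp add: expfam_kl_ext_def theta_mean Let_def algebra_simps)
  qed
  also have "\<dots> \<longleftrightarrow> (\<forall>\<theta>\<in>\<Theta>. real n * (x * (\<theta> - \<theta>q) - (F \<theta> - F \<theta>q)) \<le> b)"
    using n by (auto simp: field_simps)
  finally show ?thesis .
qed

section \<open>The index: monotonicity and threshold crossing\<close>

definition level :: "real \<Rightarrow> nat \<Rightarrow> real" where
  "level c t = ln (real t) + c * ln (ln (real t))"

lemma index_eq:
  assumes "n > 0"
  shows "klucb4p_index \<Theta> \<rho> Af F c t n m = Sup ({ereal m} \<union>
    {ereal (mean \<theta>q) | \<theta>q. \<theta>q \<in> \<Theta> \<and> m < mean \<theta>q \<and>
       (\<forall>\<theta>\<in>\<Theta>. real n * (m * (\<theta> - \<theta>q) - (F \<theta> - F \<theta>q)) \<le> level c t)})"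
proof -
  have "{ereal q | q. q \<in> mean ` \<Theta> \<and> m < q \<and>
       ereal (real n) * expfam_kl_ext \<Theta> \<rho> Af F m q \<le> ereal (level c t)}
     = {ereal (mean \<theta>q) | \<theta>q. \<theta>q \<in> \<Theta> \<and> m < mean \<theta>q \<and>
       (\<forall>\<theta>\<in>\<Theta>. real n * (m * (\<theta> - \<theta>q) - (F \<theta> - F \<theta>q)) \<le> level c t)}"
    using kl_ext_le_iff[OF _ assms] by blast
  then show ?thesis unfolding klucb4p_index_def level_def by presburger
qed

text \<open>Raising \<open>m\<close> weakens the constraints with \<theta> \<le> \<theta>q, whose
  slope in \<open>m\<close> is nonpositive. Those with \<theta> > \<theta>q hold by the support line
  as long as \<open>m'\<close> stays below \<open>mean \<theta>q\<close>.\<close>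

lemma index_mono:
  assumes n: "n > 0" and le: "m \<le> m'"
  shows "klucb4p_index \<Theta> \<rho> Af F c t n m \<le> klucb4p_index \<Theta> \<rho> Af F c t n m'"
  unfolding index_eq[OF n, of c t m]
proof (rule Sup_least)
  let ?u = "klucb4p_index \<Theta> \<rho> Af F c t n m'"
  have m': "ereal m' \<le> ?u" unfolding klucb4p_index_def by (rule Sup_upper) simp
  fix z assume "z \<in> {ereal m} \<union>
    {ereal (mean \<theta>q) | \<theta>q. \<theta>q \<in> \<Theta> \<and> m < mean \<theta>q \<and>
       (\<forall>\<theta>\<in>\<Theta>. real n * (m * (\<theta> - \<theta>q) - (F \<theta> - F \<theta>q)) \<le> level c t)}"
  then consider "z = ereal m" | \<theta>q where "z = ereal (mean \<theta>q)" "\<theta>q \<in> \<Theta>"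
     "\<forall>\<theta>\<in>\<Theta>. real n * (m * (\<theta> - \<theta>q) - (F \<theta> - F \<theta>q)) \<le> level c t"
    by blast
  then show "z \<le> ?u"
  proof cases
    case 1
    then show ?thesis using le m' by (metis ereal_less_eq(3) order_trans)
  next
    case 2
    show ?thesis
    proof (cases "mean \<theta>q \<le> m'")
      case True
      then show ?thesis using 2 m' by (metis ereal_less_eq(3) order_trans)
    next
      case False
      have "real n * (m' * (\<theta> - \<theta>q) - (F \<theta> - F \<theta>q)) \<le> level c t" if "\<theta> \<in> \<Theta>" for \<theta>
      proof (cases "\<theta> \<le> \<theta>q")
        case True
        then have "m' * (\<theta> - \<theta>q) \<le> m * (\<theta> - \<theta>q)"
          using le by (intro mult_right_mono_neg) auto
        then have "real n * (m' * (\<theta> - \<theta>q) - (F \<theta> - F \<theta>q)) \<le> real n * (m * (\<theta> - \<theta>q) - (F \<theta> - F \<theta>q))"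
          by (intro mult_left_mono) auto
        then show ?thesis using 2 that by force
      next
        case F: False
        have "m' * (\<theta> - \<theta>q) \<le> mean \<theta>q * (\<theta> - \<theta>q)"
          using F False by (intro mult_right_mono) auto
        then have "m' * (\<theta> - \<theta>q) - (F \<theta> - F \<theta>q) \<le> 0"
          using support_line[OF 2(2) that] by linarith
        then have "real n * (m' * (\<theta> - \<theta>q) - (F \<theta> - F \<theta>q)) \<le> 0"
          by (simp add: mult_nonneg_nonpos)
        \<comment> \<open>The level can be negative for small \<open>t\<close>, but the constraint
          at \<theta> = \<theta>q has left side 0.\<close>
        also have "0 \<le> level c t" using 2 by fastforce
        finally show ?thesis .
      qed
      then show ?thesis unfolding index_eq[OF n]
        using 2 False by (intro Sup_upper) auto
    qed
  qed
qed

text \<open>For the profitable arm: the true mean exceeds the index, hence is not feasible, and a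
  violated constraint supplies the parameter of a large likelihood ratio.\<close>

lemma index_less_mean:
  assumes n: "n > 0" and u: "klucb4p_index \<Theta> \<rho> Af F c t n m < ereal \<tau>"
    and \<theta>: "\<theta> \<in> \<Theta>" "\<tau> < mean \<theta>"
  shows "m < mean \<theta>" "\<exists>\<theta>'\<in>\<Theta>. level c t < real n * (m * (\<theta>' - \<theta>) - (F \<theta>' - F \<theta>))"
proof -
  have "ereal m \<le> klucb4p_index \<Theta> \<rho> Af F c t n m"
    unfolding klucb4p_index_def by (rule Sup_upper) simp
  then have "ereal m < ereal \<tau>" using u by (rule le_less_trans)
  then show m: "m < mean \<theta>" using \<theta>(2) by simp
  show "\<exists>\<theta>'\<in>\<Theta>. level c t < real n * (m * (\<theta>' - \<theta>) - (F \<theta>' - F \<theta>))"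
  proof (rule ccontr)
    assume "\<not> ?thesis"
    then have "ereal (mean \<theta>) \<le> klucb4p_index \<Theta> \<rho> Af F c t n m"
      unfolding index_eq[OF n] using \<theta>(1) m
      by (intro Sup_upper) (auto simp: not_less)
    then have "ereal (mean \<theta>) < ereal \<tau>" using u by (rule le_less_trans)
    then show False using \<theta>(2) by simp
  qed
qed

text \<open>For the unprofitable arm. By monotonicity it is enough to refute an empirical mean equal
  to \<open>mean \<theta>r\<close>, where the constraint at \<theta>r reads
  \<open>n * kl_param \<theta>r \<theta>q \<le> level c t\<close>. The parameter \<theta>' lies
  strictly below the threshold because the supremum need not be attained.\<close>

lemma mean_le_index:
  assumes n: "n > 0" and u: "ereal \<tau> \<le> klucb4p_index \<Theta> \<rho> Af F c t n m"
    and \<theta>: "\<theta>r \<in> \<Theta>" "\<theta>' \<in> \<Theta>" "\<theta>r < \<theta>'" "mean \<theta>' < \<tau>"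
    and lev: "level c t < real n * kl_param \<theta>r \<theta>'"
  shows "mean \<theta>r < m"
proof (rule ccontr)
  assume "\<not> ?thesis"
  then have "ereal \<tau> \<le> klucb4p_index \<Theta> \<rho> Af F c t n (mean \<theta>r)"
    using index_mono[OF n] u order_trans not_less by blast
  moreover have "ereal (mean \<theta>') < ereal \<tau>" using \<theta> by simp
  ultimately have "ereal (mean \<theta>') < klucb4p_index \<Theta> \<rho> Af F c t n (mean \<theta>r)"
    by (rule less_le_trans[rotated])
  then obtain z where z: "ereal (mean \<theta>') < z" "z \<in> {ereal (mean \<theta>r)} \<union>
    {ereal (mean \<theta>q) | \<theta>q. \<theta>q \<in> \<Theta> \<and> mean \<theta>r < mean \<theta>q \<and>
       (\<forall>\<theta>\<in>\<Theta>. real n * (mean \<theta>r * (\<theta> - \<theta>q) - (F \<theta> - F \<theta>q)) \<le> level c t)}"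
    unfolding index_eq[OF n] less_Sup_iff by blast
  have "mean \<theta>r < mean \<theta>'" using mean_less_iff \<theta> by simp
  with z obtain \<theta>q where q: "\<theta>q \<in> \<Theta>" "mean \<theta>' < mean \<theta>q"
       "real n * (mean \<theta>r * (\<theta>r - \<theta>q) - (F \<theta>r - F \<theta>q)) \<le> level c t"
    using \<theta> by force
  have "kl_param \<theta>r \<theta>' \<le> kl_param \<theta>r \<theta>q"
    using \<theta> q mean_less_iff by (intro kl_param_mono) auto
  then have "real n * kl_param \<theta>r \<theta>' \<le> real n * kl_param \<theta>r \<theta>q"
    by (intro mult_left_mono) auto
  also have "\<dots> \<le> level c t"
    using q(3) by (simp add: kl_param_def algebra_simps)
  finally show False using lev by simp
qed

text \<open>Continuity in each argument: first \<theta> is moved up to \<theta>r, then \<tau> down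
  to \<theta>', at a small loss of divergence. The gap between \<theta> and \<theta>r later yields
  the exponential decay, the gap between \<theta>' and \<tau> the strictness needed for a
  supremum.\<close>

lemma intermediate_params:
  assumes "\<theta> \<in> \<Theta>" "\<tau> \<in> \<Theta>" "\<theta> < \<tau>" "b < kl_param \<theta> \<tau>"
  obtains \<theta>r \<theta>' where "\<theta>r \<in> \<Theta>" "\<theta>' \<in> \<Theta>" "\<theta> < \<theta>r" "\<theta>r < \<theta>'" "\<theta>' < \<tau>" "b < kl_param \<theta>r \<theta>'"
proof -
  have cF: "isCont F x" if "x \<in> \<Theta>" for x
    using mean_deriv[OF that] by (rule DERIV_isCont)
  have "isCont (\<lambda>x. kl_param x \<tau>) \<theta>"
    unfolding kl_param_def by (intro continuous_intros cF isCont_mean assms)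
  then have "((\<lambda>x. kl_param x \<tau>) \<longlongrightarrow> kl_param \<theta> \<tau>) (at_right \<theta>)"
    by (simp add: continuous_at filterlim_at_split)
  then have "\<forall>\<^sub>F x in at_right \<theta>. b < kl_param x \<tau>"
    using assms(4) order_tendstoD(1) by blast
  moreover have "\<forall>\<^sub>F x in at_right \<theta>. x \<in> {\<theta><..<\<tau>}"
    using assms(3) by (rule eventually_at_right_real)
  ultimately have "\<exists>x. b < kl_param x \<tau> \<and> x \<in> {\<theta><..<\<tau>}"
    using eventually_happens'[OF trivial_limit_at_right_real] eventually_conj by blast
  then obtain \<theta>r where r: "b < kl_param \<theta>r \<tau>" "\<theta> < \<theta>r" "\<theta>r < \<tau>" by auto
  then have r\<Theta>: "\<theta>r \<in> \<Theta>" using interval_mem[OF assms(1,2)] by simp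
  have "isCont (\<lambda>x. kl_param \<theta>r x) \<tau>"
    unfolding kl_param_def by (intro continuous_intros cF assms)
  then have "((\<lambda>x. kl_param \<theta>r x) \<longlongrightarrow> kl_param \<theta>r \<tau>) (at_left \<tau>)"
    by (simp add: continuous_at filterlim_at_split)
  then have "\<forall>\<^sub>F x in at_left \<tau>. b < kl_param \<theta>r x"
    using r(1) order_tendstoD(1) by blast
  moreover have "\<forall>\<^sub>F x in at_left \<tau>. x \<in> {\<theta>r<..<\<tau>}"
    using r(3) by (rule eventually_at_left_real)
  ultimately have "\<exists>x. b < kl_param \<theta>r x \<and> x \<in> {\<theta>r<..<\<tau>}"
    using eventually_happens'[OF trivial_limit_at_left_real] eventually_conj by blast
  then obtain \<theta>' where "b < kl_param \<theta>r \<theta>'" "\<theta>r < \<theta>'" "\<theta>' < \<tau>" by auto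
  moreover have "\<theta>' \<in> \<Theta>" using interval_mem[OF r\<Theta> assms(2)] calculation by simp
  ultimately show ?thesis using that r r\<Theta> by blast
qed

end

section \<open>The state of a single arm\<close>

text \<open>A single arm: \<open>f (Inl t)\<close> is the number of clients of round \<open>t\<close> and \<open>f (Inr (c, t))\<close> the
  reward of client \<open>c\<close>. The state is (rounds played, clients served, total reward), and
  \<open>g t s\<close> says whether the arm is played in round \<open>t + 1\<close> from state \<open>s\<close>.\<close>

definition clients :: "nat \<Rightarrow> (nat + nat \<times> nat \<Rightarrow> real) \<Rightarrow> nat" where
  "clients t f = nat \<lfloor>f (Inl t)\<rfloor>"

definition reward_sum :: "nat \<Rightarrow> (nat + nat \<times> nat \<Rightarrow> real) \<Rightarrow> real" where
  "reward_sum t f = (\<Sum>c\<in>{1..clients t f}. f (Inr (c, t)))"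

primrec arm_state :: "(nat \<Rightarrow> nat \<times> nat \<times> real \<Rightarrow> bool) \<Rightarrow> nat \<Rightarrow> (nat + nat \<times> nat \<Rightarrow> real) \<Rightarrow> nat \<times> nat \<times> real" where
  "arm_state g 0 f = (0, 0, 0)"
| "arm_state g (Suc t) f =
     (if g t (arm_state g t f) then
        (Suc (fst (arm_state g t f)), fst (snd (arm_state g t f)) + clients (Suc t) f,
         snd (snd (arm_state g t f)) + reward_sum (Suc t) f)
      else arm_state g t f)"

text \<open>All potential clients of the round belong to the block, since the number that arrives is
  random.\<close>

definition round_vars :: "nat \<Rightarrow> (nat + nat \<times> nat) set" where
  "round_vars t = insert (Inl t) {Inr (c, t) | c. 1 \<le> c}"

definition past_vars :: "nat \<Rightarrow> (nat + nat \<times> nat) set" where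
  "past_vars t = (\<Union>s\<in>{1..t}. round_vars s)"

abbreviation state_space :: "(nat \<times> nat \<times> real) measure" where
  "state_space \<equiv> count_space UNIV \<Otimes>\<^sub>M (count_space UNIV \<Otimes>\<^sub>M borel)"

lemma clients_measurable:
  assumes "Inl t \<in> J"
  shows "clients t \<in> PiM J (\<lambda>_. borel) \<rightarrow>\<^sub>M count_space UNIV"
proof -
  have [measurable]: "(\<lambda>f. f (Inl t)) \<in> borel_measurable (PiM J (\<lambda>_. borel :: real measure))"
    using assms by (rule measurable_component_singleton)
  show ?thesis unfolding clients_def[abs_def] by measurable
qed

lemma reward_sum_measurable:
  assumes "round_vars t \<subseteq> J"
  shows "reward_sum t \<in> borel_measurable (PiM J (\<lambda>_. borel))"
proof -
  have [measurable]: "clients t \<in> PiM J (\<lambda>_. borel) \<rightarrow>\<^sub>M count_space UNIV"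
    using assms by (intro clients_measurable) (auto simp: round_vars_def)
  have [measurable]: "(\<lambda>f. \<Sum>c\<in>{1..n}. f (Inr (c, t))) \<in> borel_measurable (PiM J (\<lambda>_. borel :: real measure))" for n
    using assms by (intro borel_measurable_sum measurable_component_singleton) (auto simp: round_vars_def)
  show ?thesis unfolding reward_sum_def[abs_def]
    by (rule measurable_compose_countable[where f="\<lambda>n f. \<Sum>c\<in>{1..n}. f (Inr (c, t))" and g="clients t"]) measurable
qed

lemma arm_state_measurable:
  assumes g: "\<And>t. Measurable.pred state_space (g t)" and J: "past_vars t \<subseteq> J"
  shows "arm_state g t \<in> PiM J (\<lambda>_. borel) \<rightarrow>\<^sub>M state_space"
  using J
proof (induction t)
  case 0
  then show ?case by simp
next
  case (Suc t)
  have "past_vars t \<subseteq> J" using Suc.prems unfolding past_vars_def by force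
  then have [measurable]: "arm_state g t \<in> PiM J (\<lambda>_. borel) \<rightarrow>\<^sub>M state_space" by (rule Suc.IH)
  have J: "round_vars (Suc t) \<subseteq> J" using Suc.prems unfolding past_vars_def by force
  have [measurable]: "reward_sum (Suc t) \<in> borel_measurable (PiM J (\<lambda>_. borel))"
     "clients (Suc t) \<in> PiM J (\<lambda>_. borel) \<rightarrow>\<^sub>M count_space UNIV"
    using J by (auto intro!: reward_sum_measurable, auto intro!: clients_measurable simp: round_vars_def)
  note [measurable] = g
  show ?case unfolding arm_state.simps by measurable
qed

lemma clients_restrict: "Inl t \<in> J \<Longrightarrow> clients t (restrict f J) = clients t f"
  by (simp add: clients_def)

lemma reward_sum_restrict: "round_vars t \<subseteq> J \<Longrightarrow> reward_sum t (restrict f J) = reward_sum t f"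
  unfolding reward_sum_def by (rule sum.cong) (auto simp: clients_def round_vars_def)

text \<open>Predictability: the state after \<open>t\<close> rounds reads only the coordinates of
  these rounds, hence is independent of the block of the next round.\<close>

lemma arm_state_restrict: "past_vars t \<subseteq> J \<Longrightarrow> arm_state g t (restrict f J) = arm_state g t f"
proof (induction t)
  case (Suc t)
  have "past_vars t \<subseteq> J" using Suc.prems unfolding past_vars_def by force
  moreover have J: "round_vars (Suc t) \<subseteq> J" using Suc.prems unfolding past_vars_def by force
  moreover have "Inl (Suc t) \<in> J" using J by (auto simp: round_vars_def)
  ultimately show ?case using Suc.IH by (simp only: arm_state.simps clients_restrict reward_sum_restrict)
qed simp

text \<open>Every play leading to a total of at most \<open>j\<close> starts from fewer than
  \<open>j\<close> plays, so the added condition never blocks it.\<close>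

lemma stopped_state_eq:
  "fst (arm_state g t f) \<le> j \<Longrightarrow> arm_state (\<lambda>t s. g t s \<and> fst s < j) t f = arm_state g t f"
proof (induction t)
  case (Suc t)
  then have "fst (arm_state g t f) \<le> j" by (auto split: if_splits)
  then show ?case using Suc by (auto split: if_splits)
qed simp

lemma stopped_state_frozen:
  assumes "t \<le> t'" "fst (arm_state (\<lambda>t s. g t s \<and> fst s < j) t f) = j"
  shows "arm_state (\<lambda>t s. g t s \<and> fst s < j) t' f = arm_state (\<lambda>t s. g t s \<and> fst s < j) t f"
  using assms by (induction t' rule: dec_induct) auto

lemma rounds_state_mono: "t \<le> t' \<Longrightarrow> fst (arm_state g t f) \<le> fst (arm_state g t' f)"
  by (induction t' rule: dec_induct) auto

lemma rounds_state_le: "fst (arm_state g t f) \<le> t"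
  by (induction t) auto

text \<open>Each play raises the counter, so plays may be indexed by the number of earlier plays
  instead of by time.\<close>

lemma rounds_state_inj: "inj_on (\<lambda>t. fst (arm_state g t f)) {t. g t (arm_state g t f)}"
proof -
  have "fst (arm_state g t f) < fst (arm_state g t' f)" if "t < t'" "g t (arm_state g t f)" for t t'
    using rounds_state_mono[of "Suc t" t' g f] that by simp
  then show ?thesis unfolding inj_on_def by (metis (no_types, lifting) linorder_neq_iff mem_Collect_eq)
qed

section \<open>Likelihood ratios along a predictable policy\<close>

locale arm_process = prob_space M + exp_family \<Theta> \<rho> Af F
  for M :: "'w measure" and \<Theta> \<rho> Af F +
  fixes \<theta> :: real and C :: "nat \<Rightarrow> 'w \<Rightarrow> nat" and X :: "nat \<Rightarrow> nat \<Rightarrow> 'w \<Rightarrow> real" and cm cp :: nat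
    and Z :: "nat + nat \<times> nat \<Rightarrow> 'w \<Rightarrow> real"
  assumes \<theta>: "\<theta> \<in> \<Theta>"
    and cm: "1 \<le> cm"
    and C_bounds: "\<And>t \<omega>. 1 \<le> t \<Longrightarrow> \<omega> \<in> space M \<Longrightarrow> cm \<le> C t \<omega> \<and> C t \<omega> \<le> cp"
    and X_distr: "\<And>c t. 1 \<le> c \<Longrightarrow> 1 \<le> t \<Longrightarrow> distr M borel (X c t) = nu \<theta>"
    and indep: "indep_vars (\<lambda>_. borel) Z ({Inl t | t. 1 \<le> t} \<union> {Inr (c, t) | c t. 1 \<le> c \<and> 1 \<le> t})"
    and Z_eq: "Z = (\<lambda>i. case i of Inl t \<Rightarrow> (\<lambda>\<omega>. real (C t \<omega>)) | Inr (c, t) \<Rightarrow> X c t)"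
begin

abbreviation vars :: "'w \<Rightarrow> nat + nat \<times> nat \<Rightarrow> real" where
  "vars \<omega> \<equiv> (\<lambda>i. Z i \<omega>)"

abbreviation st :: "(nat \<Rightarrow> nat \<times> nat \<times> real \<Rightarrow> bool) \<Rightarrow> nat \<Rightarrow> 'w \<Rightarrow> nat \<times> nat \<times> real" where
  "st g t \<omega> \<equiv> arm_state g t (vars \<omega>)"

text \<open>The likelihood ratio of \<theta>' against the true parameter for the rewards collected
  so far.\<close>

definition tilt :: "real \<Rightarrow> nat \<times> nat \<times> real \<Rightarrow> real" where
  "tilt \<theta>' s = exp ((\<theta>' - \<theta>) * snd (snd s) - real (fst (snd s)) * (F \<theta>' - F \<theta>))"

lemma clients_vars [simp]: "clients t (vars \<omega>) = C t \<omega>"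
  by (simp add: clients_def Z_eq)

lemma reward_sum_vars [simp]: "reward_sum t (vars \<omega>) = (\<Sum>c\<in>{1..C t \<omega>}. X c t \<omega>)"
  unfolding reward_sum_def clients_vars by (simp add: Z_eq)

lemma indep_past_round:
  assumes "1 \<le> t"
    and "\<phi> \<in> borel_measurable (PiM (past_vars (t - 1)) (\<lambda>_. borel))"
    and "\<psi> \<in> borel_measurable (PiM (round_vars t) (\<lambda>_. borel))"
  shows "indep_var borel (\<lambda>\<omega>. \<phi> (restrict (vars \<omega>) (past_vars (t - 1)))) borel (\<lambda>\<omega>. \<psi> (restrict (vars \<omega>) (round_vars t)))"
proof -
  have 1: "past_vars (t - 1) \<inter> round_vars t = {}"
    using assms(1) by (auto simp: past_vars_def round_vars_def)
  have 2: "past_vars (t - 1) \<subseteq> {Inl t | t. 1 \<le> t} \<union> {Inr (c, t) | c t. 1 \<le> c \<and> 1 \<le> t}"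
    by (auto simp: past_vars_def round_vars_def)
  have 3: "round_vars t \<subseteq> {Inl t | t. 1 \<le> t} \<union> {Inr (c, t) | c t. 1 \<le> c \<and> 1 \<le> t}"
    using assms(1) by (auto simp: round_vars_def)
  show ?thesis
    using indep_var_compose[OF indep_var_restrict[OF indep 1 2 3] assms(2,3)] by (simp add: comp_def)
qed

lemma Z_measurable:
  assumes "i \<in> {Inl t | t. 1 \<le> t} \<union> {Inr (c, t) | c t. 1 \<le> c \<and> 1 \<le> t}"
  shows "Z i \<in> borel_measurable M"
  using indep assms unfolding indep_vars_def by blast

lemma vars_measurable:
  assumes "J \<subseteq> {Inl t | t. 1 \<le> t} \<union> {Inr (c, t) | c t. 1 \<le> c \<and> 1 \<le> t}"
  shows "(\<lambda>\<omega>. restrict (vars \<omega>) J) \<in> M \<rightarrow>\<^sub>M PiM J (\<lambda>_. borel)"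
  using assms by (intro measurable_restrict Z_measurable) auto

lemma st_measurable:
  assumes "\<And>t. Measurable.pred state_space (g t)"
  shows "st g t \<in> M \<rightarrow>\<^sub>M state_space"
proof -
  have "(\<lambda>\<omega>. arm_state g t (restrict (vars \<omega>) (past_vars t))) \<in> M \<rightarrow>\<^sub>M state_space"
    by (rule measurable_compose[OF vars_measurable arm_state_measurable[OF assms]])
       (auto simp: past_vars_def round_vars_def)
  then show ?thesis by (simp add: arm_state_restrict)
qed

lemma C_measurable: "1 \<le> t \<Longrightarrow> (\<lambda>\<omega>. real (C t \<omega>)) \<in> borel_measurable M"
  using Z_measurable[of "Inl t"] by (simp add: Z_eq)

lemma C_measurable_count: "1 \<le> t \<Longrightarrow> C t \<in> M \<rightarrow>\<^sub>M count_space UNIV"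
proof -
  assume "1 \<le> t"
  note [measurable] = C_measurable[OF this]
  have "(\<lambda>\<omega>. nat \<lfloor>real (C t \<omega>)\<rfloor>) \<in> M \<rightarrow>\<^sub>M count_space UNIV" by measurable
  then show ?thesis by simp
qed

lemma C_integrable: "1 \<le> t \<Longrightarrow> integrable M (\<lambda>\<omega>. real (C t \<omega>))"
  by (rule integrable_const_bound[where B="real cp"])
     (use C_bounds C_measurable in auto)

text \<open>The test depends on the past and the next group size does not. The test \<open>h\<close>
  is separate from the policy \<open>g\<close> because both the rounds played and the rounds not
  played have to be counted.\<close>

lemma expectation_played:
  assumes g: "\<And>t. Measurable.pred state_space (g t)" and h: "Measurable.pred state_space h"
  shows "(\<integral>\<omega>. real (C (Suc t) \<omega>) * indicator {\<omega>. h (st g t \<omega>)} \<omega> \<partial>M)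
     = (\<integral>\<omega>. real (C (Suc t) \<omega>) \<partial>M) * \<P>(\<omega> in M. h (st g t \<omega>))"
    and "integrable M (\<lambda>\<omega>. real (C (Suc t) \<omega>) * indicator {\<omega>. h (st g t \<omega>)} \<omega>)"
proof -
  note [measurable] = g h arm_state_measurable[OF g order_refl] st_measurable[OF g]
  have m: "(\<lambda>f. indicator {f. h (arm_state g t f)} f :: real) \<in> borel_measurable (PiM (past_vars (Suc t - 1)) (\<lambda>_. borel))"
    by simp
  have [measurable]: "clients (Suc t) \<in> PiM (round_vars (Suc t)) (\<lambda>_. borel) \<rightarrow>\<^sub>M count_space UNIV"
    by (rule clients_measurable) (simp add: round_vars_def)
  have m': "(\<lambda>f. real (clients (Suc t) f)) \<in> borel_measurable (PiM (round_vars (Suc t)) (\<lambda>_. borel))"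
    by measurable
  have "Inl (Suc t) \<in> round_vars (Suc t)" by (simp add: round_vars_def)
  then have ind: "indep_var borel (\<lambda>\<omega>. indicator {\<omega>. h (st g t \<omega>)} \<omega> :: real) borel (\<lambda>\<omega>. real (C (Suc t) \<omega>))"
    using indep_past_round[OF _ m m'] by (simp add: arm_state_restrict clients_restrict indicator_def)
  have int: "integrable M (\<lambda>\<omega>. indicator {\<omega>. h (st g t \<omega>)} \<omega> :: real)"
    by (rule integrable_const_bound[where B=1]) (auto simp: indicator_def)
  have eq: "(\<integral>\<omega>. indicator {\<omega>. h (st g t \<omega>)} \<omega> \<partial>M) = \<P>(\<omega> in M. h (st g t \<omega>))"
  proof -
    have "(\<integral>\<omega>. indicator {\<omega>. h (st g t \<omega>)} \<omega> \<partial>M) = (\<integral>\<omega>. indicator {\<omega>\<in>space M. h (st g t \<omega>)} \<omega> \<partial>M)"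
      by (intro Bochner_Integration.integral_cong) (auto simp: indicator_def)
    moreover have "{\<omega>. h (st g t \<omega>)} \<inter> space M = {\<omega>\<in>space M. h (st g t \<omega>)}" by auto
    ultimately show ?thesis by simp
  qed
  show "(\<integral>\<omega>. real (C (Suc t) \<omega>) * indicator {\<omega>. h (st g t \<omega>)} \<omega> \<partial>M)
     = (\<integral>\<omega>. real (C (Suc t) \<omega>) \<partial>M) * \<P>(\<omega> in M. h (st g t \<omega>))"
    using indep_var_lebesgue_integral[OF ind int C_integrable] eq by (simp add: mult.commute)
  show "integrable M (\<lambda>\<omega>. real (C (Suc t) \<omega>) * indicator {\<omega>. h (st g t \<omega>)} \<omega>)"
    using indep_var_integrable[OF ind int C_integrable] by (simp add: mult.commute)
qed

lemma
  assumes "1 \<le> c" "1 \<le> t" "\<theta>' \<in> \<Theta>"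
  shows integrable_tilt_reward: "integrable M (\<lambda>\<omega>. exp ((\<theta>' - \<theta>) * X c t \<omega> - (F \<theta>' - F \<theta>)))"
    and integral_tilt_reward: "(\<integral>\<omega>. exp ((\<theta>' - \<theta>) * X c t \<omega> - (F \<theta>' - F \<theta>)) \<partial>M) = 1"
proof -
  have X [measurable]: "X c t \<in> borel_measurable M"
    using Z_measurable[of "Inr (c, t)"] assms by (simp add: Z_eq)
  have m: "(\<lambda>x. exp ((\<theta>' - \<theta>) * x - (F \<theta>' - F \<theta>))) \<in> borel_measurable borel" by simp
  show "integrable M (\<lambda>\<omega>. exp ((\<theta>' - \<theta>) * X c t \<omega> - (F \<theta>' - F \<theta>)))"
    using integrable_tilt[OF \<theta> assms(3)] integrable_distr_eq[OF X m] X_distr[OF assms(1,2)] by simp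
  show "(\<integral>\<omega>. exp ((\<theta>' - \<theta>) * X c t \<omega> - (F \<theta>' - F \<theta>)) \<partial>M) = 1"
    using integral_tilt[OF \<theta> assms(3)] integral_distr[OF X m] X_distr[OF assms(1,2)] by simp
qed

text \<open>With the group size fixed at \<open>k\<close>, the indicator and the \<open>k\<close>
  reward factors are functions of finitely many independent variables, and each reward factor has
  expectation 1.\<close>

lemma tilt_round_fixed:
  assumes t: "1 \<le> t" and \<theta>': "\<theta>' \<in> \<Theta>"
  defines "Y \<equiv> \<lambda>k \<omega>. indicator {\<omega>. C t \<omega> = k} \<omega> * (\<Prod>c\<in>{1..k}. exp ((\<theta>' - \<theta>) * X c t \<omega> - (F \<theta>' - F \<theta>)))"
  shows "integrable M (Y k)" "(\<integral>\<omega>. Y k \<omega> \<partial>M) = \<P>(\<omega> in M. C t \<omega> = k)"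
proof -
  define h :: "nat + nat \<times> nat \<Rightarrow> real \<Rightarrow> real" where
    "h = (\<lambda>i x. case i of Inl _ \<Rightarrow> indicator {real k} x | Inr _ \<Rightarrow> exp ((\<theta>' - \<theta>) * x - (F \<theta>' - F \<theta>)))"
  define J where "J = insert (Inl t) ((\<lambda>c. Inr (c, t) :: nat + nat \<times> nat) ` {1..k})"
  have J: "J \<subseteq> {Inl t | t. 1 \<le> t} \<union> {Inr (c, t) | c t. 1 \<le> c \<and> 1 \<le> t}" "finite J"
    using t by (auto simp: J_def)
  have ind: "indep_vars (\<lambda>_. borel) (\<lambda>i \<omega>. h i (Z i \<omega>)) J"
    by (rule indep_vars_compose2[OF indep_vars_subset[OF indep J(1)]]) (rename_tac i, case_tac i; simp add: h_def)
  note [measurable] = C_measurable_count[OF t]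
  have intC: "integrable M (\<lambda>\<omega>. indicator {real k} (real (C t \<omega>)) :: real)"
    by (rule integrable_const_bound[where B=1]) (auto simp: indicator_def)
  have int: "integrable M (\<lambda>\<omega>. h i (Z i \<omega>))" if "i \<in> J" for i
    using that integrable_tilt_reward[OF _ t \<theta>'] intC by (auto simp: J_def h_def Z_eq)
  have Yk: "(\<Prod>i\<in>J. h i (Z i \<omega>)) = Y k \<omega>" for \<omega>
    by (simp add: J_def Y_def prod.reindex inj_on_def h_def Z_eq indicator_def image_iff)
  show "integrable M (Y k)"
    using indep_vars_integrable[OF J(2) ind int] by (simp add: Yk)
  have "(\<integral>\<omega>. Y k \<omega> \<partial>M) = (\<Prod>i\<in>J. \<integral>\<omega>. h i (Z i \<omega>) \<partial>M)"
    using indep_vars_lebesgue_integral[OF J(2) ind int] by (simp add: Yk)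
  also have "\<dots> = (\<integral>\<omega>. indicator {real k} (real (C t \<omega>)) \<partial>M)"
    by (simp add: J_def prod.reindex inj_on_def h_def Z_eq image_iff integral_tilt_reward[OF _ t \<theta>'])
  also have "\<dots> = (\<integral>\<omega>. indicator {\<omega>\<in>space M. C t \<omega> = k} \<omega> \<partial>M)"
    by (intro Bochner_Integration.integral_cong) (auto simp: indicator_def)
  finally show "(\<integral>\<omega>. Y k \<omega> \<partial>M) = \<P>(\<omega> in M. C t \<omega> = k)" by simp
qed

text \<open>The product has a random number of factors; since \<open>cp\<close> bounds it, the
  values of the group size split it into finitely many products of fixed length.\<close>

lemma tilt_round:
  assumes t: "1 \<le> t" and \<theta>': "\<theta>' \<in> \<Theta>"
  defines "B \<equiv> \<lambda>\<omega>. exp ((\<theta>' - \<theta>) * (\<Sum>c\<in>{1..C t \<omega>}. X c t \<omega>) - real (C t \<omega>) * (F \<theta>' - F \<theta>))"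
  shows "integrable M B" "(\<integral>\<omega>. B \<omega> \<partial>M) = 1"
proof -
  define Y where "Y = (\<lambda>k \<omega>. indicator {\<omega>. C t \<omega> = k} \<omega> * (\<Prod>c\<in>{1..k}. exp ((\<theta>' - \<theta>) * X c t \<omega> - (F \<theta>' - F \<theta>))))"
  have Y: "integrable M (Y k)" "(\<integral>\<omega>. Y k \<omega> \<partial>M) = \<P>(\<omega> in M. C t \<omega> = k)" for k
    unfolding Y_def using tilt_round_fixed[OF t \<theta>'] by blast+
  have B: "B \<omega> = (\<Sum>k\<le>cp. Y k \<omega>)" if "\<omega> \<in> space M" for \<omega>
  proof -
    have "(\<Sum>k\<le>cp. Y k \<omega>) = (\<Sum>k\<in>{C t \<omega>}. Y k \<omega>)"
      by (rule sum.mono_neutral_right) (use C_bounds[OF t that] in \<open>auto simp: Y_def\<close>)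
    also have "\<dots> = B \<omega>"
      by (simp add: Y_def B_def exp_sum[symmetric] sum_subtractf sum_distrib_left)
    finally show ?thesis ..
  qed
  note [measurable] = C_measurable_count[OF t]
  have "integrable M B \<longleftrightarrow> integrable M (\<lambda>\<omega>. \<Sum>k\<le>cp. Y k \<omega>)"
    using B by (intro Bochner_Integration.integrable_cong) auto
  then show "integrable M B" using Y by auto
  have "(\<integral>\<omega>. B \<omega> \<partial>M) = (\<integral>\<omega>. (\<Sum>k\<le>cp. Y k \<omega>) \<partial>M)"
    using B by (intro Bochner_Integration.integral_cong) auto
  also have "\<dots> = (\<Sum>k\<le>cp. \<P>(\<omega> in M. C t \<omega> = k))"
    using Y by (subst Bochner_Integration.integral_sum) auto
  also have "\<dots> = prob (\<Union>k\<le>cp. {\<omega>\<in>space M. C t \<omega> = k})"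
    by (rule finite_measure_finite_Union[symmetric]) (auto simp: disjoint_family_on_def)
  also have "(\<Union>k\<le>cp. {\<omega>\<in>space M. C t \<omega> = k}) = space M" using C_bounds[OF t] by auto
  finally show "(\<integral>\<omega>. B \<omega> \<partial>M) = 1" by (simp add: prob_space)
qed

lemma expectation_tilt:
  assumes g: "\<And>t. Measurable.pred state_space (g t)" and \<theta>': "\<theta>' \<in> \<Theta>"
  shows "integrable M (\<lambda>\<omega>. tilt \<theta>' (st g t \<omega>)) \<and> (\<integral>\<omega>. tilt \<theta>' (st g t \<omega>) \<partial>M) = 1"
proof (induction t)
  case 0
  show ?case by (simp add: tilt_def prob_space)
next
  case (Suc t)
  note [measurable] = g arm_state_measurable[OF g order_refl] st_measurable[OF g]
  have [measurable]: "tilt \<theta>' \<in> borel_measurable state_space"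
    unfolding tilt_def[abs_def] by measurable
  define G where "G = (\<lambda>s. indicator {s. g t s} s * tilt \<theta>' s)"
  have [measurable]: "G \<in> borel_measurable state_space" unfolding G_def by measurable
  define B where "B = (\<lambda>\<omega>. exp ((\<theta>' - \<theta>) * (\<Sum>c\<in>{1..C (Suc t) \<omega>}. X c (Suc t) \<omega>) - real (C (Suc t) \<omega>) * (F \<theta>' - F \<theta>)))"
  have B: "integrable M B" "(\<integral>\<omega>. B \<omega> \<partial>M) = 1"
    unfolding B_def using tilt_round[OF _ \<theta>', of "Suc t"] by auto
  have m: "(\<lambda>f. G (arm_state g t f)) \<in> borel_measurable (PiM (past_vars (Suc t - 1)) (\<lambda>_. borel))"
    by simp
  have [measurable]: "clients (Suc t) \<in> PiM (round_vars (Suc t)) (\<lambda>_. borel) \<rightarrow>\<^sub>M count_space UNIV"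
      "reward_sum (Suc t) \<in> borel_measurable (PiM (round_vars (Suc t)) (\<lambda>_. borel))"
    by (rule clients_measurable reward_sum_measurable; simp add: round_vars_def)+
  have m': "(\<lambda>f. exp ((\<theta>' - \<theta>) * reward_sum (Suc t) f - real (clients (Suc t) f) * (F \<theta>' - F \<theta>)))
      \<in> borel_measurable (PiM (round_vars (Suc t)) (\<lambda>_. borel))"
    by measurable
  have "Inl (Suc t) \<in> round_vars (Suc t)" by (simp add: round_vars_def)
  then have ind: "indep_var borel (\<lambda>\<omega>. G (st g t \<omega>)) borel B"
    using indep_past_round[OF _ m m'] 
    by (simp add: arm_state_restrict clients_restrict reward_sum_restrict B_def)
  have int: "integrable M (\<lambda>\<omega>. G (st g t \<omega>))"
  proof (rule Bochner_Integration.integrable_bound)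
    show "integrable M (\<lambda>\<omega>. tilt \<theta>' (st g t \<omega>))" using Suc by simp
  qed (auto simp: G_def indicator_def)
  \<comment> \<open>The martingale step: on the event of playing, carried by \<open>G\<close>, the
    ratio gains the independent factor \<open>B\<close> of expectation 1; elsewhere it is
    unchanged.\<close>
  have eq: "tilt \<theta>' (st g (Suc t) \<omega>) = G (st g t \<omega>) * B \<omega> + (tilt \<theta>' (st g t \<omega>) - G (st g t \<omega>))" for \<omega>
    by (simp add: G_def B_def tilt_def exp_add[symmetric] algebra_simps)
  note i = indep_var_integrable[OF ind int B(1)] and e = indep_var_lebesgue_integral[OF ind int B(1)]
  show ?case unfolding eq using i e int Suc B by simp
qed

text \<open>Chernoff's method at a fixed time; the sample size stays random, and \<open>h\<close>
  may restrict it.\<close>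

lemma tilt_Markov:
  assumes g: "\<And>t. Measurable.pred state_space (g t)" and \<theta>': "\<theta>' \<in> \<Theta>"
    and h: "Measurable.pred state_space h"
    and le: "\<And>s. h s \<Longrightarrow> exp b \<le> tilt \<theta>' s"
  shows "\<P>(\<omega> in M. h (st g t \<omega>)) \<le> exp (- b)"
proof -
  note [measurable] = g h st_measurable[OF g]
  have [measurable]: "tilt \<theta>' \<in> borel_measurable state_space"
    unfolding tilt_def[abs_def] by measurable
  have "\<P>(\<omega> in M. h (st g t \<omega>)) \<le> \<P>(\<omega> in M. exp b \<le> tilt \<theta>' (st g t \<omega>))"
    by (rule finite_measure_mono) (auto intro: le)
  also have "\<dots> \<le> (\<integral>\<omega>. tilt \<theta>' (st g t \<omega>) \<partial>M) / exp b"
    using expectation_tilt[OF g \<theta>', where t=t]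
    by (intro integral_Markov_inequality_measure[where A="{}"]) (auto simp: tilt_def)
  also have "\<dots> = exp (- b)"
    using expectation_tilt[OF g \<theta>', where t=t] by (simp add: exp_minus field_simps)
  finally show ?thesis .
qed

end

section \<open>The decision rule and its measurability\<close>

context exp_family
begin

text \<open>The case \<open>t = 0\<close> is the forced first round; the value 0 without
  observations is the convention of \<open>hist_muhat\<close>.\<close>

definition play :: "real \<Rightarrow> real \<Rightarrow> nat \<Rightarrow> nat \<times> nat \<times> real \<Rightarrow> bool" where
  "play c \<tau> t s \<longleftrightarrow> t = 0 \<or> ereal \<tau> \<le> klucb4p_index \<Theta> \<rho> Af F c t (fst (snd s))
     (if fst (snd s) = 0 then 0 else snd (snd s) / real (fst (snd s)))"

lemma play_0 [simp]: "play c \<tau> 0 s"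
  by (simp add: play_def)

text \<open>No measurability of the uncountable supremum is needed: for each client count the
  accepted reward totals form an up-closed set of reals, hence an interval, and the counts are
  countable.\<close>

lemma play_measurable: "Measurable.pred state_space (play c \<tau> t)"
proof -
  define P where "P = (\<lambda>n x. t = 0 \<or> ereal \<tau> \<le> klucb4p_index \<Theta> \<rho> Af F c t n (if n = 0 then 0 else x / real n))"
  have "Measurable.pred borel (P n)" for n
  proof -
    have "P n y" if "P n x" "x \<le> y" for x y
    proof (cases "n = 0")
      case False
      then have "x / real n \<le> y / real n" using that by (simp add: divide_right_mono)
      then have "klucb4p_index \<Theta> \<rho> Af F c t n (x / real n) \<le> klucb4p_index \<Theta> \<rho> Af F c t n (y / real n)"
        using index_mono False by blast
      then show ?thesis using that(1) False unfolding P_def by (auto intro: order_trans)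
    qed (use that in \<open>simp add: P_def\<close>)
    then have "is_interval {x. P n x}" unfolding is_interval_1 by blast
    then have "{x. P n x} \<in> sets borel" by (rule real_interval_borel_measurable)
    then show ?thesis by (simp add: pred_def)
  qed
  note [measurable] = this
  have "(\<lambda>s. P (fst (snd s)) (snd (snd s))) \<in> state_space \<rightarrow>\<^sub>M count_space UNIV"
    by (rule measurable_compose_countable[where f="\<lambda>n s. P n (snd (snd s))" and g="\<lambda>s. fst (snd s)"]) measurable
  also have "(\<lambda>s. P (fst (snd s)) (snd (snd s))) = play c \<tau> t"
    by (rule ext) (simp only: P_def play_def)
  finally show ?thesis .
qed

end

section \<open>Lower deviations and the profitable arm\<close>

text \<open>A nonempty bounded down-closed set is a half-line, closed or open at its supremum. The
  closed case is one instance of the hypothesis; the open case follows by continuity from below.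
  This avoids a union bound over the uncountably many parameters that may witness a
  deviation.\<close>

lemma (in prob_space) prob_down_set_le:
  fixes Y :: "'a \<Rightarrow> real"
  assumes Y [measurable]: "Y \<in> borel_measurable M" and Q [measurable]: "Measurable.pred M Q"
    and bdd: "bdd_above S" and down: "\<And>x y. x \<in> S \<Longrightarrow> y \<le> x \<Longrightarrow> y \<in> S"
    and le: "\<And>y. y \<in> S \<Longrightarrow> \<P>(\<omega> in M. Y \<omega> \<le> y \<and> Q \<omega>) \<le> p" and p: "0 \<le> p"
  shows "\<P>(\<omega> in M. Y \<omega> \<in> S \<and> Q \<omega>) \<le> p"
proof -
  consider "S = {}" | "S \<noteq> {}" "Sup S \<in> S" | "S \<noteq> {}" "Sup S \<notin> S" by blast
  then show ?thesis
  proof cases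
    case 1
    then show ?thesis using p by simp
  next
    case 2
    then have "S = {..Sup S}" using bdd down cSup_upper by blast
    then have "\<P>(\<omega> in M. Y \<omega> \<in> S \<and> Q \<omega>) = \<P>(\<omega> in M. Y \<omega> \<le> Sup S \<and> Q \<omega>)" by (metis atMost_iff)
    then show ?thesis using le 2 by simp
  next
    case 3
    have S: "x \<in> S \<longleftrightarrow> x < Sup S" for x
    proof
      assume "x \<in> S"
      then show "x < Sup S" using cSup_upper[OF _ bdd] 3 by (metis less_eq_real_def)
    next
      assume "x < Sup S"
      then show "x \<in> S" using less_cSup_iff[OF 3(1) bdd] down by (metis less_imp_le)
    qed
    define A where "A n = {\<omega> \<in> space M. Y \<omega> \<le> Sup S - 1 / real (Suc n) \<and> Q \<omega>}" for n
    have "(\<lambda>n. prob (A n)) \<longlonglongrightarrow> prob (\<Union>n. A n)"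
    proof (rule finite_Lim_measure_incseq)
      show "range A \<subseteq> events" by (auto simp: A_def)
      have "A m \<subseteq> A n" if "m \<le> n" for m n
      proof -
        have "1 / real (Suc n) \<le> 1 / real (Suc m)" using that by (simp add: frac_le)
        then show ?thesis by (auto simp: A_def)
      qed
      then show "incseq A" by (simp add: incseq_def)
    qed
    moreover have "(\<Union>n. A n) = {\<omega> \<in> space M. Y \<omega> \<in> S \<and> Q \<omega>}"
    proof safe
      fix \<omega> n assume "\<omega> \<in> A n"
      then show "\<omega> \<in> space M" "Q \<omega>" by (auto simp: A_def)
      have "Y \<omega> \<le> Sup S - 1 / real (Suc n)" using \<open>\<omega> \<in> A n\<close> by (simp add: A_def)
      also have "\<dots> < Sup S" by simp
      finally show "Y \<omega> \<in> S" using S by blast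
    next
      fix \<omega> assume "\<omega> \<in> space M" "Y \<omega> \<in> S" "Q \<omega>"
      then have "0 < Sup S - Y \<omega>" using S[of "Y \<omega>"] by simp
      then obtain n where "1 / real (Suc n) < Sup S - Y \<omega>"
        by (metis inverse_eq_divide reals_Archimedean)
      then show "\<omega> \<in> (\<Union>n. A n)" using \<open>\<omega> \<in> space M\<close> \<open>Q \<omega>\<close>
        by (intro UN_I[of n]) (auto simp: A_def)
    qed
    ultimately have "(\<lambda>n. prob (A n)) \<longlonglongrightarrow> \<P>(\<omega> in M. Y \<omega> \<in> S \<and> Q \<omega>)" by simp
    moreover have "prob (A n) \<le> p" for n
      unfolding A_def by (rule le) (use S in \<open>simp del: of_nat_Suc\<close>)
    ultimately show ?thesis by (intro LIMSEQ_le_const2) auto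
  qed
qed

lemma geometric_slice:
  fixes r x :: real
  assumes r: "1 < r" and x: "1 \<le> x" "x \<le> r ^ D" and D: "1 \<le> D"
  shows "\<exists>k\<in>{1..D}. r ^ (k - 1) \<le> x \<and> x \<le> r ^ k"
proof -
  define k where "k = (LEAST k. x \<le> r ^ k)"
  have k: "x \<le> r ^ k" "k \<le> D" unfolding k_def using x(2) by (auto intro: LeastI Least_le)
  show ?thesis
  proof (cases "k = 0")
    \<comment> \<open>Here \<open>x = 1\<close>, the left end of the first slice.\<close>
    case True
    then show ?thesis using k x r D by (intro bexI[of _ 1]) auto
  next
    case False
    then have "\<not> x \<le> r ^ (k - 1)" unfolding k_def by (intro not_less_Least) simp
    then show ?thesis using k False by (intro bexI[of _ k]) auto
  qed
qed

context arm_process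
begin

text \<open>Below the true mean, the support line makes the exponent nonpositive for every \<theta>'
  \<ge> \<theta>. Witnesses therefore lie to the left, and a witness for \<open>x\<close> also
  serves every smaller value.\<close>

lemma deviation_param_less:
  assumes "\<theta>' \<in> \<Theta>" "x < mean \<theta>" "0 < x * (\<theta>' - \<theta>) - (F \<theta>' - F \<theta>)"
  shows "\<theta>' < \<theta>"
proof (rule ccontr)
  assume "\<not> \<theta>' < \<theta>"
  then have "x * (\<theta>' - \<theta>) \<le> mean \<theta> * (\<theta>' - \<theta>)" using assms by (intro mult_right_mono) auto
  with support_line[OF \<theta> assms(1)] assms(3) show False by simp
qed

text \<open>Peeling: cutting the range of the sample size into geometric slices of ratio
  \<open>\<delta> / (\<delta> - 1)\<close> loses only a factor \<open>e\<close> in each slice.\<close>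
lemma deviation_bound:
  assumes g: "\<And>t. Measurable.pred state_space (g t)" and h: "Measurable.pred state_space h"
    and \<delta>: "1 < \<delta>" and n: "2 \<le> n"
    and N: "\<And>\<omega>. \<omega> \<in> space M \<Longrightarrow> 1 \<le> fst (snd (st g t \<omega>)) \<and> fst (snd (st g t \<omega>)) \<le> n"
    and dev: "\<And>k m S. h (k, m, S) \<Longrightarrow> 1 \<le> m \<Longrightarrow> S / real m < mean \<theta> \<and>
        (\<exists>\<theta>'\<in>\<Theta>. \<delta> < real m * (S / real m * (\<theta>' - \<theta>) - (F \<theta>' - F \<theta>)))"
  shows "\<P>(\<omega> in M. h (st g t \<omega>)) \<le> exp 1 * (\<delta> * ln (real n) + 1) * exp (- \<delta>)"
proof -
  note [measurable] = g h st_measurable[OF g]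
  \<comment> \<open>Chosen so that \<delta> / r = \<delta> - 1: replacing the upper end of a slice
    by its lower end costs exactly 1 in the exponent, whence the factor \<open>exp 1\<close>. The
    bound \<open>ln r \<ge> 1 / \<delta>\<close> keeps the number \<open>D\<close> of slices below
    \<open>\<delta> * ln n + 1\<close>.\<close>
  define r where "r = \<delta> / (\<delta> - 1)"
  define D where "D = nat \<lceil>ln (real n) / ln r\<rceil>"
  have r: "1 < r" using \<delta> by (simp add: r_def field_simps)
  have lnr: "1 / \<delta> \<le> ln r"
  proof -
    have "ln (1 - 1 / \<delta>) \<le> (1 - 1 / \<delta>) - 1" using \<delta> by (intro ln_le_minus_one) (simp add: field_simps)
    moreover have "ln r = - ln (1 - 1 / \<delta>)"
    proof -
      have "r = inverse (1 - 1 / \<delta>)" using \<delta> by (simp add: r_def field_simps)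
      then show ?thesis using \<delta> by (simp add: ln_inverse)
    qed
    ultimately show ?thesis by simp
  qed
  have lnr0: "0 < ln r" using r by simp
  have lnn: "0 < ln (real n)" using n by simp
  have D1: "1 \<le> D" using lnn lnr0 by (simp add: D_def Suc_le_eq)
  have D2: "real D \<le> \<delta> * ln (real n) + 1"
  proof -
    have "1 \<le> ln r * \<delta>" using lnr \<delta> by (simp add: field_simps)
    then have "ln (real n) * 1 \<le> ln (real n) * (ln r * \<delta>)" using lnn by (intro mult_left_mono) auto
    then have "ln (real n) / ln r \<le> \<delta> * ln (real n)" using lnr0 by (simp add: field_simps)
    moreover have "real D = of_int \<lceil>ln (real n) / ln r\<rceil>"
      using lnn lnr0 by (simp add: D_def of_nat_nat)
    ultimately show ?thesis using of_int_ceiling_le_add_one[of "ln (real n) / ln r"] by linarith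
  qed
  have nD: "real n \<le> r ^ D"
  proof -
    have "ln (real n) / ln r \<le> real D" unfolding D_def by linarith
    then have "ln (real n) \<le> ln (r ^ D)" using lnr0 r by (simp add: ln_realpow field_simps)
    then show ?thesis using r n by (subst (asm) ln_le_cancel_iff) auto
  qed
  \<comment> \<open>In slice \<open>k\<close> the sample size is at most \<open>r ^ k\<close>, so
    the deviation implies a condition on the empirical mean alone.\<close>
  define S where "S k = {x. x < mean \<theta> \<and> (\<exists>\<theta>'\<in>\<Theta>. \<delta> / r ^ k < x * (\<theta>' - \<theta>) - (F \<theta>' - F \<theta>))}" for k
  have pos: "0 < \<delta> / r ^ k" for k using \<delta> r by simp
  have down: "y \<in> S k" if "x \<in> S k" "y \<le> x" for x y k
  proof -
    obtain \<theta>' where \<theta>': "x < mean \<theta>" "\<theta>' \<in> \<Theta>" "\<delta> / r ^ k < x * (\<theta>' - \<theta>) - (F \<theta>' - F \<theta>)"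
      using \<open>x \<in> S k\<close> by (auto simp: S_def)
    have "\<theta>' < \<theta>" using \<theta>' pos[of k] by (intro deviation_param_less[of \<theta>' x]) auto
    then have "x * (\<theta>' - \<theta>) \<le> y * (\<theta>' - \<theta>)" using \<open>y \<le> x\<close> by (intro mult_right_mono_neg) auto
    with \<theta>' \<open>y \<le> x\<close> show ?thesis by (auto simp: S_def intro!: bexI[of _ \<theta>'])
  qed
  define Y :: "nat \<times> nat \<times> real \<Rightarrow> real" where "Y = (\<lambda>s. snd (snd s) / real (fst (snd s)))"
  have [measurable]: "Y \<in> borel_measurable state_space" unfolding Y_def by measurable
  define E where "E k = {\<omega> \<in> space M. Y (st g t \<omega>) \<in> S k \<and> r ^ (k - 1) \<le> real (fst (snd (st g t \<omega>)))}" for k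
  have S_meas [measurable]: "S k \<in> sets borel" for k
    by (rule real_interval_borel_measurable) (use down in \<open>unfold is_interval_1, blast\<close>)
  have E_le: "prob (E k) \<le> exp (- (\<delta> - 1))" if k: "1 \<le> k" for k
    unfolding E_def
  proof (rule prob_down_set_le)
    show "bdd_above (S k)" by (auto simp: S_def bdd_above_def intro: less_imp_le)
    fix y assume "y \<in> S k"
    then obtain \<theta>' where \<theta>': "y < mean \<theta>" "\<theta>' \<in> \<Theta>" "\<delta> / r ^ k < y * (\<theta>' - \<theta>) - (F \<theta>' - F \<theta>)"
      by (auto simp: S_def)
    have less: "\<theta>' < \<theta>" using \<theta>' pos[of k] by (intro deviation_param_less[of \<theta>' y]) auto
    \<comment> \<open>The witness of \<open>y\<close> works for all empirical means up to
      \<open>y\<close>, so one likelihood ratio bounds the whole half-line.\<close>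
    show "\<P>(\<omega> in M. Y (st g t \<omega>) \<le> y \<and> r ^ (k - 1) \<le> real (fst (snd (st g t \<omega>)))) \<le> exp (- (\<delta> - 1))"
    proof (rule tilt_Markov[OF g \<theta>'(2), where h="\<lambda>s. Y s \<le> y \<and> r ^ (k - 1) \<le> real (fst (snd s))"])
      fix s assume s: "Y s \<le> y \<and> r ^ (k - 1) \<le> real (fst (snd s))"
      have "\<delta> - 1 = r ^ (k - 1) * (\<delta> / r ^ k)"
        using r k \<delta> by (cases k) (auto simp: r_def field_simps)
      also have "\<dots> \<le> real (fst (snd s)) * (y * (\<theta>' - \<theta>) - (F \<theta>' - F \<theta>))"
        using s \<theta>'(3) pos[of k] by (intro mult_mono) auto
      also have "\<dots> \<le> real (fst (snd s)) * (Y s * (\<theta>' - \<theta>) - (F \<theta>' - F \<theta>))"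
        using s less by (intro mult_left_mono diff_mono mult_right_mono_neg) auto
      also have "\<dots> = (\<theta>' - \<theta>) * snd (snd s) - real (fst (snd s)) * (F \<theta>' - F \<theta>)"
      proof -
        have "0 < r ^ (k - 1)" using r by simp
        then have "real (fst (snd s)) \<noteq> 0" using s by linarith
        then show ?thesis by (simp add: Y_def field_simps)
      qed
      finally show "exp (\<delta> - 1) \<le> tilt \<theta>' s" by (simp add: tilt_def)
    qed measurable
  qed (use down in auto)
  have "\<P>(\<omega> in M. h (st g t \<omega>)) \<le> prob (\<Union>k\<in>{1..D}. E k)"
  proof (rule finite_measure_mono)
    show "(\<Union>k\<in>{1..D}. E k) \<in> events" unfolding E_def by measurable
    show "{\<omega> \<in> space M. h (st g t \<omega>)} \<subseteq> (\<Union>k\<in>{1..D}. E k)"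
    proof safe
      fix \<omega> assume \<omega>: "\<omega> \<in> space M" "h (st g t \<omega>)"
      obtain j m s where s: "st g t \<omega> = (j, m, s)" by (cases "st g t \<omega>")
      have m: "1 \<le> m" "m \<le> n" using N[OF \<omega>(1)] s by auto
      obtain k where k: "k \<in> {1..D}" "r ^ (k - 1) \<le> real m" "real m \<le> r ^ k"
        using geometric_slice[OF r _ _ D1, of "real m"] nD m by auto
      obtain \<theta>' where \<theta>': "s / real m < mean \<theta>" "\<theta>' \<in> \<Theta>" "\<delta> < real m * (s / real m * (\<theta>' - \<theta>) - (F \<theta>' - F \<theta>))"
        using dev[of j m s] \<omega>(2) s m by auto
      have "\<delta> / r ^ k \<le> \<delta> / real m" using k m \<delta> by (intro divide_left_mono) auto
      also have "\<dots> < s / real m * (\<theta>' - \<theta>) - (F \<theta>' - F \<theta>)"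
        using \<theta>'(3) m by (subst pos_divide_less_eq) (auto simp: mult.commute)
      finally have "s / real m \<in> S k" using \<theta>' by (auto simp: S_def)
      then show "\<omega> \<in> (\<Union>k\<in>{1..D}. E k)"
        using k \<omega> s by (intro UN_I[of k]) (auto simp: E_def Y_def)
    qed
  qed
  also have "\<dots> \<le> (\<Sum>k\<in>{1..D}. prob (E k))"
    by (rule finite_measure_subadditive_finite) (auto simp: E_def)
  also have "\<dots> \<le> (\<Sum>k\<in>{1..D}. exp (- (\<delta> - 1)))" by (intro sum_mono E_le) auto
  also have "\<dots> = real D * (exp 1 * exp (- \<delta>))" by (simp add: exp_add[symmetric])
  also have "\<dots> \<le> (\<delta> * ln (real n) + 1) * (exp 1 * exp (- \<delta>))"
    using D2 by (intro mult_right_mono) auto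
  finally show ?thesis by (simp add: mult_ac)
qed

lemma clients_state_le:
  assumes "\<omega> \<in> space M"
  shows "fst (snd (st g t \<omega>)) \<le> cp * t"
proof (induction t)
  case (Suc t)
  then show ?case using C_bounds[OF _ assms, of "Suc t"] by (auto simp: add_mono)
qed simp

lemma clients_state_ge:
  assumes "\<omega> \<in> space M"
  shows "cm * fst (st g t \<omega>) \<le> fst (snd (st g t \<omega>))"
proof (induction t)
  case (Suc t)
  then show ?case using C_bounds[OF _ assms, of "Suc t"] by (auto simp: add_mono)
qed simp

lemma rounds_state_pos:
  assumes "\<And>s. g 0 s" "1 \<le> t"
  shows "1 \<le> fst (st g t \<omega>)"
  using assms(2)
proof (induction t)
  case (Suc t)
  then show ?case using assms(1) by (cases "t = 0") auto
qed simp

lemma clients_state_pos: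
  assumes "\<And>s. g 0 s" "1 \<le> t" "\<omega> \<in> space M"
  shows "1 \<le> fst (snd (st g t \<omega>))"
proof -
  have "1 * 1 \<le> cm * fst (st g t \<omega>)"
    by (rule mult_le_mono[OF cm]) (rule rounds_state_pos, rule assms(1), rule assms(2))
  then show ?thesis using clients_state_ge[OF assms(3), of g t] by linarith
qed

end

text \<open>A discrete form of the fact that \<open>ln (ln x)\<close> has derivative
  \<open>1 / (x * ln x)\<close>, obtained from two uses of \<open>ln y \<le> y - 1\<close>.\<close>

lemma inverse_ln_le_ln_ln_diff:
  fixes x :: real
  assumes "2 < x"
  shows "1 / (x * ln x) \<le> ln (ln x) - ln (ln (x - 1))"
proof -
  have l: "0 < ln (x - 1)" "0 < ln x" using assms by auto
  have "ln (1 - 1 / x) \<le> (1 - 1 / x) - 1" using assms by (intro ln_le_minus_one) simp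
  moreover have "ln (1 - 1 / x) = ln (x - 1) - ln x"
  proof -
    have "1 - 1 / x = (x - 1) / x" using assms by (simp add: field_simps)
    then show ?thesis using assms by (simp add: ln_div)
  qed
  ultimately have 1: "1 / x \<le> ln x - ln (x - 1)" by simp
  have "ln (ln (x - 1)) - ln (ln x) = ln (ln (x - 1) / ln x)" using l by (simp add: ln_div)
  also have "\<dots> \<le> ln (x - 1) / ln x - 1" using l by (intro ln_le_minus_one) simp
  finally have "(ln x - ln (x - 1)) / ln x \<le> ln (ln x) - ln (ln (x - 1))"
    using l by (simp add: diff_divide_distrib)
  moreover have "1 / (x * ln x) \<le> (ln x - ln (x - 1)) / ln x"
    using divide_right_mono[OF 1, of "ln x"] l by simp
  ultimately show ?thesis by linarith
qed

lemma ln_ge_one: "3 \<le> x \<Longrightarrow> 1 \<le> ln (x :: real)"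
  using exp_le by (subst ln_ge_iff) auto

text \<open>Telescoping, started at 3: there the iterated logarithm is already nonnegative, and the
  sum is empty because \<open>a \<ge> 5\<close>.\<close>

lemma sum_inverse_ln_le:
  assumes "5 \<le> a" "3 \<le> T"
  shows "(\<Sum>t\<in>{a..<T}. 1 / (real t * ln (real t))) \<le> ln (ln (real T))"
proof -
  have "(\<Sum>t\<in>{a..<Suc T}. 1 / (real t * ln (real t))) \<le> ln (ln (real T))" if "3 \<le> T" for T
    using that
  proof (induction T rule: dec_induct)
    case base
    then show ?case using assms(1) ln_ge_one[of 3] by simp
  next
    case (step T)
    show ?case
    proof (cases "a \<le> Suc T")
      case True
      have "1 / (real (Suc T) * ln (real (Suc T))) \<le> ln (ln (real (Suc T))) - ln (ln (real (Suc T) - 1))"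
        using step by (intro inverse_ln_le_ln_ln_diff) simp
      then show ?thesis using step True by simp
    next
      case False
      then show ?thesis using step ln_ge_one[of "real (Suc T)"] by simp
    qed
  qed
  \<comment> \<open>The induction includes its last index, so it is applied at \<open>T - 1\<close>;
    this is too small when \<open>T = 3\<close>, where the sum is empty.\<close>
  from this[of "T - 1"] assms show ?thesis
  proof (cases "T = 3")
    case True
    then show ?thesis using assms ln_ge_one[of 3] by simp
  next
    case False
    then have "(\<Sum>t\<in>{a..<T}. 1 / (real t * ln (real t))) \<le> ln (ln (real (T - 1)))"
      using assms \<open>3 \<le> T - 1 \<Longrightarrow> _\<close> by simp
    also have "\<dots> \<le> ln (ln (real T))"
    proof -
      have "ln (real (T - 1)) \<le> ln (real T)" "1 \<le> ln (real (T - 1))"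
        using assms False ln_ge_one[of "real (T - 1)"] by auto
      then show ?thesis by (subst ln_le_cancel_iff) auto
    qed
    finally show ?thesis .
  qed
qed

context arm_process
begin

text \<open>Up to constants, peeling costs the square of \<open>ln t\<close>, while
  \<open>c \<ge> 3\<close> makes the exponential at most \<open>1 / (t * (ln t) ^ 3)\<close>; the
  quotient is summable up to an iterated logarithm.\<close>

lemma prob_not_played:
  assumes c: "3 \<le> c" and \<tau>: "\<tau> < mean \<theta>" and t: "5 \<le> t" "cp \<le> t"
  shows "\<P>(\<omega> in M. \<not> play c \<tau> t (st (play c \<tau>) t \<omega>)) \<le> exp 1 * (2 * c + 3) * (1 / (real t * ln (real t)))"
proof -
  define L where "L = ln (real t)"
  have L: "1 \<le> L" using ln_ge_one[of "real t"] t by (simp add: L_def)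
  define \<delta> where "\<delta> = level c t"
  have \<delta>_eq: "\<delta> = L + c * ln L" by (simp add: \<delta>_def level_def L_def)
  have lnL: "0 \<le> ln L" "ln L \<le> L" using L ln_le_minus_one[of L] by auto
  have "exp 1 \<noteq> real t" using exp_le t by linarith
  then have "1 < L" using L t unfolding L_def by (metis exp_ln le_neq_implies_less less_le_trans of_nat_0_less_iff zero_less_numeral order_le_less)
  moreover have "0 \<le> c * ln L" using lnL c by simp
  ultimately have \<delta>: "1 < \<delta>" by (simp add: \<delta>_eq)
  note g = play_measurable[of c \<tau>]
  have cp: "1 \<le> cp"
  proof -
    obtain \<omega> where "\<omega> \<in> space M" using not_empty by blast
    then show ?thesis using C_bounds[of 1 \<omega>] cm by auto
  qed
  have n: "2 \<le> cp * t" using mult_le_mono[OF cp t(1)] by simp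
  have "\<P>(\<omega> in M. \<not> play c \<tau> t (st (play c \<tau>) t \<omega>)) \<le> exp 1 * (\<delta> * ln (real (cp * t)) + 1) * exp (- \<delta>)"
  proof (rule deviation_bound[OF g _ \<delta> n])
    show "Measurable.pred state_space (\<lambda>s. \<not> play c \<tau> t s)" using g by measurable
    show "1 \<le> fst (snd (st (play c \<tau>) t \<omega>)) \<and> fst (snd (st (play c \<tau>) t \<omega>)) \<le> cp * t" if "\<omega> \<in> space M" for \<omega>
      using clients_state_le[OF that] clients_state_pos[OF _ _ that, of "play c \<tau>" t] t by simp
    fix k m S assume "\<not> play c \<tau> t (k, m, S)" "1 \<le> m"
    then show "S / real m < mean \<theta> \<and>
        (\<exists>\<theta>'\<in>\<Theta>. \<delta> < real m * (S / real m * (\<theta>' - \<theta>) - (F \<theta>' - F \<theta>)))"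
      using index_less_mean[of m c t "S / real m" \<tau> \<theta>] \<theta> \<tau> by (simp add: play_def \<delta>_def not_le)
  qed
  \<comment> \<open>From \<open>cp \<le> t\<close> the logarithm of the maximal sample size is at
    most \<open>2 * L\<close>, and \<delta> is at most \<open>(1 + c) * L\<close>. Together they
    give \<open>2 * c + 2\<close>; the last unit absorbs the \<open>+ 1\<close>.\<close>
  also have "\<dots> \<le> exp 1 * ((2 * c + 3) * L\<^sup>2) * exp (- \<delta>)"
  proof -
    have "ln (real (cp * t)) = ln (real cp) + L" using cp t by (simp add: ln_mult L_def)
    also have "\<dots> \<le> 2 * L" using cp t by (simp add: L_def)
    finally have "\<delta> * ln (real (cp * t)) \<le> \<delta> * (2 * L)" using \<delta> by (intro mult_left_mono) auto
    also have "\<dots> \<le> (L + c * L) * (2 * L)" unfolding \<delta>_eq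
      using L lnL c by (intro mult_right_mono add_left_mono mult_left_mono) auto
    finally have "\<delta> * ln (real (cp * t)) + 1 \<le> (2 * c + 3) * L\<^sup>2"
      using L one_le_power[of L 2] by (simp add: power2_eq_square algebra_simps)
    then show ?thesis by (intro mult_left_mono mult_right_mono) auto
  qed
  also have "\<dots> \<le> exp 1 * ((2 * c + 3) * L\<^sup>2) * (1 / (real t * L ^ 3))"
  proof -
    have "exp (- \<delta>) = 1 / (real t * exp (c * ln L))"
      unfolding \<delta>_eq exp_minus exp_add using t by (simp add: L_def inverse_eq_divide)
    also have "\<dots> \<le> 1 / (real t * L ^ 3)"
    proof -
      have "L ^ 3 = exp (3 * ln L)" using L by (simp add: exp_of_nat_mult[of 3, simplified])
      also have "\<dots> \<le> exp (c * ln L)" using c lnL by (simp add: mult_right_mono)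
      finally show ?thesis using L t by (intro divide_left_mono mult_left_mono mult_pos_pos) auto
    qed
    finally show ?thesis using c by (intro mult_left_mono) auto
  qed
  also have "\<dots> = exp 1 * (2 * c + 3) * (1 / (real t * L))"
    using L t by (simp add: field_simps power2_eq_square power3_eq_cube)
  finally show ?thesis by (simp add: L_def)
qed

lemma sum_prob_not_played:
  assumes c: "3 \<le> c" and \<tau>: "\<tau> < mean \<theta>" and T: "3 \<le> T"
  shows "(\<Sum>t<T. \<P>(\<omega> in M. \<not> play c \<tau> t (st (play c \<tau>) t \<omega>)))
     \<le> exp 1 * (2 * c + 3) * ln (ln (real T)) + real cp + 3"
proof -
  define P where "P t = \<P>(\<omega> in M. \<not> play c \<tau> t (st (play c \<tau>) t \<omega>))" for t
  \<comment> \<open>Indices in \<open>{1..<a}\<close> are bounded by 1 each, and index 0 contributes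
    nothing because the first round is always played. Starting at 5 is affordable even for
    \<open>cp = 1\<close>, where \<open>5 - 1 = cp + 3\<close>.\<close>
  define a where "a = max 5 cp"
  have a: "5 \<le> a" "real a - 1 \<le> real cp + 3"
  proof -
    obtain \<omega> where "\<omega> \<in> space M" using not_empty by blast
    then show "5 \<le> a" "real a - 1 \<le> real cp + 3" using C_bounds[of 1 \<omega>] cm by (auto simp: a_def)
  qed
  have "(\<Sum>t<T. P t) \<le> (\<Sum>t\<in>insert 0 ({1..<a} \<union> {a..<T}). P t)"
    by (rule sum_mono2) (auto simp: P_def)
  also have "\<dots> = (\<Sum>t\<in>{1..<a} \<union> {a..<T}. P t)"
    using a by (subst sum.insert) (auto simp: P_def)
  also have "\<dots> = (\<Sum>t\<in>{1..<a}. P t) + (\<Sum>t\<in>{a..<T}. P t)"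
    by (rule sum.union_disjoint) auto
  also have "(\<Sum>t\<in>{1..<a}. P t) \<le> (\<Sum>t\<in>{1..<a}. 1)"
    by (rule sum_mono) (simp add: P_def)
  also have "\<dots> = real a - 1" using a by (simp add: of_nat_diff)
  also have "(\<Sum>t\<in>{a..<T}. P t) \<le> (\<Sum>t\<in>{a..<T}. exp 1 * (2 * c + 3) * (1 / (real t * ln (real t))))"
    unfolding P_def by (intro sum_mono prob_not_played assms) (auto simp: a_def)
  also have "\<dots> \<le> exp 1 * (2 * c + 3) * ln (ln (real T))"
    unfolding sum_distrib_left[symmetric]
    using c by (intro mult_left_mono sum_inverse_ln_le a T) auto
  finally show ?thesis using a by (simp add: P_def)
qed

end

section \<open>The unprofitable arm\<close>

context arm_process
begin

text \<open>The \<open>j\<close>-th play happens at a random time; stopping the policy after \<open>j\<close> plays turns the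
  state at that time into the state at the fixed time \<open>T\<close>.\<close>
lemma sum_prob_played:
  assumes T: "3 \<le> T" and c: "0 < c" and \<epsilon>: "0 < \<epsilon>"
    and \<theta>\<tau>: "\<theta>\<tau> \<in> \<Theta>" "\<theta> < \<theta>\<tau>"
    and \<theta>r: "\<theta>r \<in> \<Theta>" "\<theta>' \<in> \<Theta>" "\<theta> < \<theta>r" "\<theta>r < \<theta>'" "\<theta>' < \<theta>\<tau>"
    and kl: "kl_param \<theta> \<theta>\<tau> / (1 + \<epsilon>) < kl_param \<theta>r \<theta>'"
  defines "g \<equiv> play c (mean \<theta>\<tau>)" and "D \<equiv> kl_param \<theta> \<theta>\<tau>" and "d \<equiv> kl_param \<theta>r \<theta>"
  shows "(\<Sum>t<T. \<P>(\<omega> in M. g t (st g t \<omega>)))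
    \<le> (1 + \<epsilon>) * level c T / (real cm * D) + 1
       + (1 / (1 - exp (- real cm * d))) / real T powr ((1 + \<epsilon>) * d / D)"
proof -
  have D: "0 < D" unfolding D_def using \<theta> \<theta>\<tau> by (intro kl_param_pos) auto
  have d: "0 < d" unfolding d_def using \<theta> \<theta>r by (intro kl_param_pos) auto
  have lnT: "1 \<le> ln (real T)" using T by (intro ln_ge_one) simp
  have lev_mono: "level c t \<le> level c T" if "1 \<le> t" "t \<le> T" for t
  proof (cases "t = 1")
    \<comment> \<open>At \<open>t = 1\<close> the iterated logarithm is \<open>ln 0\<close>, a
      default value, so monotonicity of \<open>ln\<close> does not apply.\<close>
    case True
    then show ?thesis using lnT c by (simp add: level_def)
  next
    case False
    then have "0 < ln (real t)" "ln (real t) \<le> ln (real T)" using that by auto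
    then have "ln (ln (real t)) \<le> ln (ln (real T))" by (subst ln_le_cancel_iff) auto
    then show ?thesis using \<open>ln (real t) \<le> ln (real T)\<close> c unfolding level_def
      by (intro add_mono mult_left_mono) auto
  qed
  have levT: "ln (real T) \<le> level c T" using lnT c by (simp add: level_def)
  \<comment> \<open>Chosen so that \<open>j > B\<close> and \<open>n \<ge> cm * j\<close> give
    \<open>n * D / (1 + \<epsilon>) > level c T\<close>; by \<open>lev_mono\<close> the final level
    serves every earlier round.\<close>
  define B where "B = (1 + \<epsilon>) * level c T / (real cm * D)"
  have B0: "0 \<le> B" using levT lnT D \<epsilon> cm by (simp add: B_def)
  define K where "K = nat \<lfloor>B\<rfloor>"
  have K: "real K \<le> B" "B < real K + 1" using B0 unfolding K_def by linarith+
  have g: "Measurable.pred state_space (g t)" for t unfolding g_def by (rule play_measurable)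
  define gj where "gj = (\<lambda>j t s. g t s \<and> fst s < (j::nat))"
  note [measurable] = g
  have gj: "Measurable.pred state_space (gj j t)" for j t
    unfolding gj_def by measurable
  define h where "h = (\<lambda>j (s::nat\<times>nat\<times>real). fst s = j \<and> 1 \<le> fst (snd s) \<and> cm * j \<le> fst (snd s) \<and>
      mean \<theta>r \<le> snd (snd s) / real (fst (snd s)))"
  have h [measurable]: "Measurable.pred state_space (h j)" for j
    unfolding h_def by measurable
  note [measurable] = st_measurable[OF g] st_measurable[OF gj]
  \<comment> \<open>Tilting towards \<theta>r is the best choice for an empirical mean at or above
    \<open>mean \<theta>r\<close>: at that value the exponent per client is
    \<open>kl_param \<theta>r \<theta> = d\<close>.\<close>
  have hP: "\<P>(\<omega> in M. h j (st (gj j) T \<omega>)) \<le> exp (- (real (cm * j) * d))" for j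
  proof (rule tilt_Markov[OF gj \<theta>r(1) h])
    fix s assume "h j s"
    then have s: "1 \<le> fst (snd s)" "real (cm * j) \<le> real (fst (snd s))" "mean \<theta>r \<le> snd (snd s) / real (fst (snd s))"
      unfolding h_def of_nat_le_iff by auto
    have "real (cm * j) * d \<le> real (fst (snd s)) * d" using s(2) d by (intro mult_right_mono) auto
    also have "\<dots> = real (fst (snd s)) * (mean \<theta>r * (\<theta>r - \<theta>) - (F \<theta>r - F \<theta>))"
      by (simp add: d_def kl_param_def algebra_simps)
    also have "\<dots> \<le> real (fst (snd s)) * (snd (snd s) / real (fst (snd s)) * (\<theta>r - \<theta>) - (F \<theta>r - F \<theta>))"
      using s(3) \<theta>r by (intro mult_left_mono diff_mono mult_right_mono) auto
    also have "\<dots> = (\<theta>r - \<theta>) * snd (snd s) - real (fst (snd s)) * (F \<theta>r - F \<theta>)"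
      using s(1) by (simp add: field_simps)
    finally show "exp (real (cm * j) * d) \<le> tilt \<theta>r s" by (simp add: tilt_def)
  qed
  have late: "h j (st (gj j) T \<omega>)"
    if \<omega>: "\<omega> \<in> space M" and t: "t < T" "g t (st g t \<omega>)" and j: "fst (st g t \<omega>) = j" "K < j" for j t \<omega>
  proof -
    have t1: "1 \<le> t" using j by (cases t) auto
    have eq: "st (gj j) t \<omega> = st g t \<omega>" unfolding gj_def using j by (intro stopped_state_eq) simp
    have "st (gj j) T \<omega> = st (gj j) t \<omega>"
      using t eq j(1) unfolding gj_def by (intro stopped_state_frozen) auto
    then have eqT: "st (gj j) T \<omega> = st g t \<omega>" using eq by simp
    obtain n S where s: "st g t \<omega> = (j, n, S)" using j(1) by (cases "st g t \<omega>") auto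
    have n: "cm * j \<le> n" using clients_state_ge[OF \<omega>, of g t] s by simp
    have n1: "1 \<le> n" using clients_state_pos[OF _ t1 \<omega>, of g] s by (simp add: g_def)
    have "mean \<theta>r < S / real n"
    proof (rule mean_le_index[where \<tau>="mean \<theta>\<tau>" and c=c and t=t and n=n and \<theta>'=\<theta>'])
      show "ereal (mean \<theta>\<tau>) \<le> klucb4p_index \<Theta> \<rho> Af F c t n (S / real n)"
        using t(2) t1 n1 s by (simp add: g_def play_def)
      show "mean \<theta>' < mean \<theta>\<tau>" using mean_less_iff \<theta>r \<theta>\<tau> by simp
      have cmp: "0 < real cm" using cm by simp
      have "B < real j" using K j by linarith
      then have "level c T < real j * (real cm * D) / (1 + \<epsilon>)"
        using \<epsilon> D cmp unfolding B_def by (simp add: field_simps)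
      then have "level c t < real (cm * j) * (D / (1 + \<epsilon>))"
        using lev_mono[OF t1] t(1) by (simp add: mult_ac)
      also have "\<dots> \<le> real n * kl_param \<theta>r \<theta>'"
        using n kl D \<epsilon> unfolding D_def[symmetric] of_nat_le_iff[symmetric, where 'a=real] by (intro mult_mono) auto
      finally show "level c t < real n * kl_param \<theta>r \<theta>'" .
    qed (use n1 \<theta>r in auto)
    then show ?thesis using eqT s n n1 by (simp add: h_def)
  qed
  have point: "(\<Sum>t<T. indicator {\<omega>\<in>space M. g t (st g t \<omega>)} \<omega>)
      \<le> real K + 1 + (\<Sum>j\<in>{Suc K..T}. indicator {\<omega>\<in>space M. h j (st (gj j) T \<omega>)} \<omega> :: real)"
    if \<omega>: "\<omega> \<in> space M" for \<omega>
  proof -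
    define P where "P = {t. t < T \<and> g t (st g t \<omega>)}"
    define Q where "Q = {j\<in>{Suc K..T}. h j (st (gj j) T \<omega>)}"
    have "card P = card ((\<lambda>t. fst (st g t \<omega>)) ` P)"
      by (rule card_image[symmetric], rule inj_on_subset[OF rounds_state_inj]) (auto simp: P_def)
    \<comment> \<open>Plays are indexed by the number of earlier plays, starting at 0, so
      \<open>K + 1\<close> of them are counted without any estimate; this is the \<open>+ 1\<close>
      of the bound.\<close>
    also have "\<dots> \<le> card ({..K} \<union> Q)"
    proof (rule card_mono)
      show "finite ({..K} \<union> Q)" by (simp add: Q_def)
      show "(\<lambda>t. fst (st g t \<omega>)) ` P \<subseteq> {..K} \<union> Q"
      proof safe
        fix t assume t: "t \<in> P" "fst (st g t \<omega>) \<notin> Q"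
        have "fst (st g t \<omega>) \<le> T" using rounds_state_le[of g t "vars \<omega>"] t by (simp add: P_def)
        then show "fst (st g t \<omega>) \<le> K"
          using late[OF \<omega>, of t] t by (force simp: P_def Q_def)
      qed
    qed
    also have "\<dots> \<le> card {..K} + card Q" by (rule card_Un_le)
    finally have "real (card P) \<le> real K + 1 + real (card Q)" by simp
    moreover have "(\<Sum>t<T. indicator {\<omega>\<in>space M. g t (st g t \<omega>)} \<omega>) = real (card P)"
    proof -
      have "P = {..<T} \<inter> {t. g t (st g t \<omega>)}" by (auto simp: P_def)
      then show ?thesis using \<omega> by (simp add: indicator_def of_bool_def[symmetric] sum.If_cases)
    qed
    moreover have "(\<Sum>j\<in>{Suc K..T}. indicator {\<omega>\<in>space M. h j (st (gj j) T \<omega>)} \<omega>) = real (card Q)"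
    proof -
      have "Q = {Suc K..T} \<inter> {j. h j (st (gj j) T \<omega>)}" by (auto simp: Q_def)
      then show ?thesis using \<omega> by (simp add: indicator_def of_bool_def[symmetric] sum.If_cases)
    qed
    ultimately show ?thesis by simp
  qed
  have int: "integrable M (indicat_real {\<omega>\<in>space M. g t (st g t \<omega>)})"
    "integrable M (indicat_real {\<omega>\<in>space M. h j (st (gj j) T \<omega>)})" for t j
    by (rule integrable_const_bound[where B=1]; simp)+
  have "(\<Sum>t<T. \<P>(\<omega> in M. g t (st g t \<omega>))) = (\<integral>\<omega>. (\<Sum>t<T. indicator {\<omega>\<in>space M. g t (st g t \<omega>)} \<omega>) \<partial>M)"
    by (subst Bochner_Integration.integral_sum) (auto intro: int)
  also have "\<dots> \<le> (\<integral>\<omega>. real K + 1 + (\<Sum>j\<in>{Suc K..T}. indicator {\<omega>\<in>space M. h j (st (gj j) T \<omega>)} \<omega>) \<partial>M)"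
    by (intro integral_mono point Bochner_Integration.integrable_add Bochner_Integration.integrable_sum int) auto
  also have "\<dots> = real K + 1 + (\<Sum>j\<in>{Suc K..T}. \<P>(\<omega> in M. h j (st (gj j) T \<omega>)))"
    using int(2) by (subst Bochner_Integration.integral_add) (auto simp: prob_space Bochner_Integration.integral_sum)
  also have "(\<Sum>j\<in>{Suc K..T}. \<P>(\<omega> in M. h j (st (gj j) T \<omega>))) \<le> (\<Sum>j\<in>{Suc K..T}. exp (- real cm * d) ^ j)"
    using hP by (intro sum_mono) (simp add: exp_of_nat_mult[symmetric] mult_ac)
  also have "\<dots> \<le> exp (- real cm * d) ^ Suc K / (1 - exp (- real cm * d))"
  proof -
    have q: "exp (- real cm * d) < 1" using cm d by simp
    then have "exp (- real cm * d) \<noteq> 1" by (rule less_imp_neq)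
    moreover have "0 \<le> exp (- real cm * d) ^ n" for n by simp
    ultimately show ?thesis using q unfolding sum_gp by (auto intro!: divide_right_mono divide_nonneg_pos simp del: power_Suc)
  qed
  \<comment> \<open>Only the part \<open>ln T\<close> of the level is kept, which makes the exponent
    independent of \<open>c\<close>.\<close>
  also have "exp (- real cm * d) ^ Suc K \<le> real T powr - ((1 + \<epsilon>) * d / D)"
  proof -
    have "(1 + \<epsilon>) * ln (real T) / (real cm * D) \<le> B"
      unfolding B_def using levT \<epsilon> cm D by (intro divide_right_mono mult_left_mono) auto
    also have "\<dots> \<le> real (Suc K)" using K by simp
    finally have "(1 + \<epsilon>) * ln (real T) / (real cm * D) * (real cm * d) \<le> real (Suc K) * (real cm * d)"
      using d by (intro mult_right_mono) auto
    moreover have "(1 + \<epsilon>) * ln (real T) / (real cm * D) * (real cm * d) = (1 + \<epsilon>) * d / D * ln (real T)"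
      using cm D by (simp add: field_simps)
    ultimately show ?thesis using T
      by (simp add: powr_def exp_of_nat_mult[symmetric] del: of_nat_Suc power_Suc)
  qed
  finally have "(\<Sum>t<T. \<P>(\<omega> in M. g t (st g t \<omega>)))
     \<le> real K + 1 + real T powr - ((1 + \<epsilon>) * d / D) / (1 - exp (- real cm * d))"
    using cm d by (simp add: divide_right_mono)
  then show ?thesis using K unfolding B_def by (simp add: powr_minus field_simps)
qed

end

section \<open>The policy\<close>

lemma length_index_policy_hist [simp]: "length (index_policy_hist K u tau t \<omega>) = t"
  by (induction t) (auto simp: Let_def)

lemma hist_N_snoc:
  "hist_N C (H @ [A]) a \<omega> = hist_N C H a \<omega> + (if a \<in> A then C a (Suc (length H)) \<omega> else 0)"
  by (simp add: hist_N_def nth_append)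

lemma hist_S_snoc:
  "hist_S C X (H @ [A]) a \<omega> = hist_S C X H a \<omega> +
     (if a \<in> A then (\<Sum>c\<in>{1..C a (Suc (length H)) \<omega>}. X a c (Suc (length H)) \<omega>) else 0)"
  by (simp add: hist_S_def nth_append)

context exp_family
begin

text \<open>The index of an arm reads only the counts and rewards of that arm, so the joint policy
  restricts to an autonomous recursion. Both claims rest on one induction: membership in the next
  set needs the current state, and the next state needs membership.\<close>

lemma policy_state:
  fixes C :: "nat \<Rightarrow> nat \<Rightarrow> 'w \<Rightarrow> nat" and X :: "nat \<Rightarrow> nat \<Rightarrow> nat \<Rightarrow> 'w \<Rightarrow> real"
    and tau :: "nat \<Rightarrow> real" and c :: real
  assumes a: "a < K" and f: "\<And>t. f (Inl t) = real (C a t \<omega>)" "\<And>i t. f (Inr (i, t)) = X a i t \<omega>"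
  defines "s \<equiv> \<lambda>t. arm_state (play c (tau a)) t f"
  defines "H \<equiv> \<lambda>t. index_policy_hist K (klucb4p_u \<Theta> \<rho> Af F c C X) tau t \<omega>"
  shows state_hist: "snd (s t) = (hist_N C (H t) a \<omega>, hist_S C X (H t) a \<omega>)"
    and mem_policy_iff: "a \<in> klucb4p_A \<Theta> \<rho> Af F c K tau C X (Suc t) \<omega> \<longleftrightarrow> play c (tau a) t (s t)"
proof -
  define A where "A t = (if t = 0 then {..<K} else {a. a < K \<and> ereal (tau a) \<le> klucb4p_u \<Theta> \<rho> Af F c C X a t (H t) \<omega>})" for t
  have H: "H (Suc t) = H t @ [A t]" "length (H t) = t" for t by (simp_all add: H_def A_def Let_def)
  have clients: "clients t f = C a t \<omega>" for t by (simp add: clients_def f)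
  have rewards: "reward_sum t f = (\<Sum>i\<in>{1..C a t \<omega>}. X a i t \<omega>)" for t
    unfolding reward_sum_def clients f ..
  have A: "a \<in> A t \<longleftrightarrow> play c (tau a) t (s t)"
    if "snd (s t) = (hist_N C (H t) a \<omega>, hist_S C X (H t) a \<omega>)" for t
    using a that by (simp add: A_def play_def klucb4p_u_def hist_muhat_def)
  show *: "snd (s t) = (hist_N C (H t) a \<omega>, hist_S C X (H t) a \<omega>)" for t
  proof (induction t)
    case 0
    show ?case by (simp add: s_def H_def hist_N_def hist_S_def)
  next
    case (Suc t)
    have "s (Suc t) = (if play c (tau a) t (s t) then
        (Suc (fst (s t)), fst (snd (s t)) + C a (Suc t) \<omega>,
         snd (snd (s t)) + (\<Sum>i\<in>{1..C a (Suc t) \<omega>}. X a i (Suc t) \<omega>)) else s t)"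
      unfolding s_def arm_state.simps clients rewards ..
    then show ?case using A[OF Suc] Suc by (simp add: H hist_N_snoc hist_S_snoc)
  qed
  have "klucb4p_A \<Theta> \<rho> Af F c K tau C X (Suc t) \<omega> = H (Suc t) ! t"
    by (simp add: klucb4p_A_def index_policy_A_def H_def del: index_policy_hist.simps)
  also have "\<dots> = A t" using H by (simp add: nth_append)
  finally show "a \<in> klucb4p_A \<Theta> \<rho> Af F c K tau C X (Suc t) \<omega> \<longleftrightarrow> play c (tau a) t (s t)"
    using A[OF *] by simp
qed

lemma bandit_arm_process:
  assumes b: "bandit_model M \<Theta> \<rho> Af F K th cm cp ctil C X T" and a: "a < K"
  shows "arm_process M \<Theta> \<rho> Af F (th a) (C a) (X a) (cm a) (cp a)
     (\<lambda>i. case i of Inl t \<Rightarrow> (\<lambda>\<omega>. real (C a t \<omega>)) | Inr (c, t) \<Rightarrow> X a c t)"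
proof -
  interpret prob_space M using b by (simp add: bandit_model_def)
  show ?thesis
    by unfold_locales (use a b expfam in \<open>auto simp: bandit_model_def\<close>)
qed

end

context arm_process
begin

lemma pulls_N_eq:
  assumes "a < K"
    and C': "\<And>t \<omega>. C' a t \<omega> = C t \<omega>" and X': "\<And>i t \<omega>. X' a i t \<omega> = X i t \<omega>"
  shows "real (pulls_N C' (klucb4p_A \<Theta> \<rho> Af F c K tau C' X') a T \<omega>)
    = (\<Sum>t<T. real (C (Suc t) \<omega>) * indicator {\<omega>. play c (tau a) t (st (play c (tau a)) t \<omega>)} \<omega>)"
proof -
  have "a \<in> klucb4p_A \<Theta> \<rho> Af F c K tau C' X' (Suc t) \<omega> \<longleftrightarrow> play c (tau a) t (st (play c (tau a)) t \<omega>)" for t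
    by (rule mem_policy_iff[OF assms(1)]) (simp_all add: Z_eq C' X')
  note mem = this
  show ?thesis
    unfolding pulls_N_def sum.atLeast1_atMost_eq One_nat_def of_nat_sum
    by (rule sum.cong) (simp_all add: mem C' indicator_def)
qed

lemma expectation_played_sum:
  assumes g: "\<And>t. Measurable.pred state_space (g t)" and h: "\<And>t. Measurable.pred state_space (h t)"
    and m: "\<And>t. t \<in> {1..T} \<Longrightarrow> (\<integral>\<omega>. real (C t \<omega>) \<partial>M) \<le> \<kappa>"
  shows "(\<integral>\<omega>. (\<Sum>t<T. real (C (Suc t) \<omega>) * indicator {\<omega>. h t (st g t \<omega>)} \<omega>) \<partial>M)
    \<le> \<kappa> * (\<Sum>t<T. \<P>(\<omega> in M. h t (st g t \<omega>)))"
proof -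
  have "(\<integral>\<omega>. (\<Sum>t<T. real (C (Suc t) \<omega>) * indicator {\<omega>. h t (st g t \<omega>)} \<omega>) \<partial>M)
    = (\<Sum>t<T. (\<integral>\<omega>. real (C (Suc t) \<omega>) \<partial>M) * \<P>(\<omega> in M. h t (st g t \<omega>)))"
    by (subst Bochner_Integration.integral_sum) (simp_all add: expectation_played[OF g h])
  also have "\<dots> \<le> (\<Sum>t<T. \<kappa> * \<P>(\<omega> in M. h t (st g t \<omega>)))"
    by (intro sum_mono mult_right_mono m) auto
  finally show ?thesis by (simp add: sum_distrib_left)
qed

end

section \<open>Expected numbers of clients for the two kinds of arm\<close>

context exp_family
begin

text \<open>The existential precedes the quantification over models to record what \<open>H\<close>
  and \<beta> may depend on. This works because \<theta>r and \<theta>' are determined by the two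
  means and \<epsilon> alone.\<close>

lemma unprofitable_arm:
  assumes \<epsilon>: "0 < \<epsilon>"
  shows "\<exists>H \<beta>. 0 < H \<and> 0 < \<beta> \<and>
      (\<forall>(M :: 'w measure) K th tau cm cp ctil C X c a T.
         bandit_model M \<Theta> \<rho> Af F K th cm cp ctil C X T \<and> 0 < c \<and> a < K \<and> cm a = k \<and>
         mean (th a) = m \<and> tau a = \<tau> \<and> m < \<tau> \<and> \<tau> \<in> mean ` \<Theta> \<and> 3 \<le> T \<longrightarrow>
         (\<integral>\<omega>. real (pulls_N C (klucb4p_A \<Theta> \<rho> Af F c K tau C X) a T \<omega>) \<partial>M)
           \<le> (1 + \<epsilon>) * ctil a * (ln (real T) + c * ln (ln (real T))) / (real k * expfam_kl \<Theta> \<rho> Af F m \<tau>)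
             + ctil a * (1 + H / real T powr \<beta>))"
proof (cases "1 \<le> k \<and> m \<in> mean ` \<Theta> \<and> \<tau> \<in> mean ` \<Theta> \<and> m < \<tau>")
  \<comment> \<open>No model meets the premises for such values, so any positive constants will
    do.\<close>
  case False
  then show ?thesis
    by (intro exI[of _ 1]) (auto simp: bandit_model_def)
next
  case True
  then obtain \<theta> \<theta>\<tau> where par: "\<theta> \<in> \<Theta>" "m = mean \<theta>" "\<theta>\<tau> \<in> \<Theta>" "\<tau> = mean \<theta>\<tau>" by blast
  have less: "\<theta> < \<theta>\<tau>" using True par mean_less_iff by simp
  have D: "0 < kl_param \<theta> \<theta>\<tau>" using par less by (intro kl_param_pos) auto
  have "kl_param \<theta> \<theta>\<tau> / (1 + \<epsilon>) < kl_param \<theta> \<theta>\<tau>" using D \<epsilon> by (simp add: field_simps)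
  then obtain \<theta>r \<theta>' where r: "\<theta>r \<in> \<Theta>" "\<theta>' \<in> \<Theta>" "\<theta> < \<theta>r" "\<theta>r < \<theta>'" "\<theta>' < \<theta>\<tau>"
      "kl_param \<theta> \<theta>\<tau> / (1 + \<epsilon>) < kl_param \<theta>r \<theta>'"
    using intermediate_params[OF par(1,3) less] by blast
  define d where "d = kl_param \<theta>r \<theta>"
  have d: "0 < d" unfolding d_def using par r by (intro kl_param_pos) auto
  define H where "H = 1 / (1 - exp (- real k * d))"
  define \<beta> where "\<beta> = (1 + \<epsilon>) * d / kl_param \<theta> \<theta>\<tau>"
  have "0 < H" "0 < \<beta>" using d D \<epsilon> True by (auto simp: H_def \<beta>_def)
  moreover have "(\<integral>\<omega>. real (pulls_N C (klucb4p_A \<Theta> \<rho> Af F c K tau C X) a T \<omega>) \<partial>M)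
           \<le> (1 + \<epsilon>) * ctil a * (ln (real T) + c * ln (ln (real T))) / (real k * expfam_kl \<Theta> \<rho> Af F m \<tau>)
             + ctil a * (1 + H / real T powr \<beta>)"
    if b: "bandit_model M \<Theta> \<rho> Af F K th cm cp ctil C X T" and c: "0 < c" and a: "a < K" "cm a = k"
      "mean (th a) = m" "tau a = \<tau>" and T: "3 \<le> T"
    for M :: "'w measure" and K th tau cm cp ctil C X c a T
  proof -
    have "th a \<in> \<Theta>" using b a by (simp add: bandit_model_def)
    then have th: "th a = \<theta>" using a(3) par theta_mean by metis
    interpret arm_process M \<Theta> \<rho> Af F \<theta> "C a" "X a" k "cp a"
      "\<lambda>i. case i of Inl t \<Rightarrow> (\<lambda>\<omega>. real (C a t \<omega>)) | Inr (c, t) \<Rightarrow> X a c t"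
      using bandit_arm_process[OF b a(1)] a th by simp
    have ctil: "0 \<le> ctil a" using b a unfolding bandit_model_def by force
    have m: "(\<integral>\<omega>. real (C a t \<omega>) \<partial>M) \<le> ctil a" if "t \<in> {1..T}" for t
      using b a that by (simp add: bandit_model_def)
    have "(\<integral>\<omega>. real (pulls_N C (klucb4p_A \<Theta> \<rho> Af F c K tau C X) a T \<omega>) \<partial>M)
      \<le> ctil a * (\<Sum>t<T. \<P>(\<omega> in M. play c \<tau> t (st (play c \<tau>) t \<omega>)))"
      using expectation_played_sum[OF play_measurable play_measurable m]
      by (simp add: pulls_N_eq[OF a(1)] a(4))
    also have "\<dots> \<le> ctil a * ((1 + \<epsilon>) * level c T / (real k * kl_param \<theta> \<theta>\<tau>) + 1 + H / real T powr \<beta>)"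
      unfolding H_def \<beta>_def d_def par(4)
      by (rule mult_left_mono[OF sum_prob_played[OF T c \<epsilon> par(3) less r] ctil])
    also have "\<dots> = (1 + \<epsilon>) * ctil a * (ln (real T) + c * ln (ln (real T))) / (real k * expfam_kl \<Theta> \<rho> Af F m \<tau>)
             + ctil a * (1 + H / real T powr \<beta>)"
      by (simp add: kl_mean par level_def algebra_simps)
    finally show ?thesis .
  qed
  ultimately show ?thesis by blast
qed

text \<open>The deficit consists of the clients in rounds not played; as group sizes are independent
  of the decision, it is at most \<open>ctil a\<close> times the summed probabilities of not
  playing.\<close>

lemma profitable_arm:
  fixes M :: "'w measure"
  assumes b: "bandit_model M \<Theta> \<rho> Af F K th cm cp ctil C X T" and c: "3 \<le> c" and a: "a < K"
    and \<tau>: "tau a < mean (th a)" and T: "3 \<le> T"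
  shows "(\<integral>\<omega>. (\<Sum>t\<in>{1..T}. real (C a t \<omega>)) \<partial>M)
         - (\<integral>\<omega>. real (pulls_N C (klucb4p_A \<Theta> \<rho> Af F c K tau C X) a T \<omega>) \<partial>M)
       \<le> ctil a * (exp 1 * (2 * c + 3) * ln (ln (real T)) + real (cp a) + 3)"
proof -
  interpret arm_process M \<Theta> \<rho> Af F "th a" "C a" "X a" "cm a" "cp a"
      "\<lambda>i. case i of Inl t \<Rightarrow> (\<lambda>\<omega>. real (C a t \<omega>)) | Inr (c, t) \<Rightarrow> X a c t"
    by (rule bandit_arm_process[OF b a])
  have ctil: "0 \<le> ctil a" using b a unfolding bandit_model_def by force
  have m: "(\<integral>\<omega>. real (C a t \<omega>) \<partial>M) \<le> ctil a" if "t \<in> {1..T}" for t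
    using b a that by (simp add: bandit_model_def)
  define g where "g = play c (tau a)"
  have g: "Measurable.pred state_space (g t)" for t unfolding g_def by (rule play_measurable)
  have g': "Measurable.pred state_space (\<lambda>s. \<not> g t s)" for t using g by measurable
  have pulls: "real (pulls_N C (klucb4p_A \<Theta> \<rho> Af F c K tau C X) a T \<omega>)
    = (\<Sum>t<T. real (C a (Suc t) \<omega>) * indicator {\<omega>. play c (tau a) t (st (play c (tau a)) t \<omega>)} \<omega>)" for \<omega>
    by (rule pulls_N_eq[OF a]) simp_all
  have "(\<integral>\<omega>. (\<Sum>t\<in>{1..T}. real (C a t \<omega>)) \<partial>M)
         - (\<integral>\<omega>. real (pulls_N C (klucb4p_A \<Theta> \<rho> Af F c K tau C X) a T \<omega>) \<partial>M)
     = (\<integral>\<omega>. (\<Sum>t\<in>{1..T}. real (C a t \<omega>)) - real (pulls_N C (klucb4p_A \<Theta> \<rho> Af F c K tau C X) a T \<omega>) \<partial>M)"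
    unfolding pulls
    by (rule Bochner_Integration.integral_diff[symmetric])
      (intro Bochner_Integration.integrable_sum C_integrable expectation_played(2) play_measurable; simp)+
  also have "\<dots> = (\<integral>\<omega>. (\<Sum>t<T. real (C a (Suc t) \<omega>) * indicator {\<omega>. \<not> g t (st g t \<omega>)} \<omega>) \<partial>M)"
    unfolding pulls sum.atLeast1_atMost_eq One_nat_def sum_subtractf[symmetric] g_def
    by (intro Bochner_Integration.integral_cong refl sum.cong) (simp add: indicator_def)
  also have "\<dots> \<le> ctil a * (\<Sum>t<T. \<P>(\<omega> in M. \<not> g t (st g t \<omega>)))"
    by (rule expectation_played_sum[OF g g' m])
  also have "\<dots> \<le> ctil a * (exp 1 * (2 * c + 3) * ln (ln (real T)) + real (cp a) + 3)"
    unfolding g_def by (intro mult_left_mono ctil sum_prob_not_played c \<tau> T)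
  finally show ?thesis .
qed

end

theorem theorem2:
  fixes \<Theta> :: "real set" and \<rho> :: "real measure" and Af F :: "real \<Rightarrow> real"
  assumes "expfam \<Theta> \<rho> Af F"
  shows
   "(\<exists>H \<beta> :: real \<Rightarrow> nat \<Rightarrow> real \<Rightarrow> real \<Rightarrow> real.
      (\<forall>\<epsilon> cm m \<tau>. 0 < \<epsilon> \<and> \<epsilon> < 1 \<longrightarrow> 0 < H \<epsilon> cm m \<tau> \<and> 0 < \<beta> \<epsilon> cm m \<tau>) \<and>
      (\<forall>(M :: 'w measure) K th tau cm cp ctil C X c a T \<epsilon>.
         bandit_model M \<Theta> \<rho> Af F K th cm cp ctil C X T \<and> 0 < c \<and> a < K \<and>
         expfam_mean \<rho> Af F (th a) < tau a \<and> tau a \<in> expfam_mean \<rho> Af F ` \<Theta> \<and>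
         0 < \<epsilon> \<and> \<epsilon> < 1 \<and> 3 \<le> T \<longrightarrow>
         (\<integral>\<omega>. real (pulls_N C (klucb4p_A \<Theta> \<rho> Af F c K tau C X) a T \<omega>) \<partial>M)
           \<le> (1 + \<epsilon>) * ctil a * (ln (real T) + c * ln (ln (real T)))
               / (real (cm a) * expfam_kl \<Theta> \<rho> Af F (expfam_mean \<rho> Af F (th a)) (tau a))
             + ctil a * (1 + H \<epsilon> (cm a) (expfam_mean \<rho> Af F (th a)) (tau a)
                          / real T powr \<beta> \<epsilon> (cm a) (expfam_mean \<rho> Af F (th a)) (tau a)))) \<and>
    (\<forall>(M :: 'w measure) K th tau cm cp ctil C X c a T.
       bandit_model M \<Theta> \<rho> Af F K th cm cp ctil C X T \<and> 3 \<le> c \<and> a < K \<and>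
       tau a < expfam_mean \<rho> Af F (th a) \<and> 3 \<le> T \<and> cp a \<le> T \<longrightarrow>
       (\<integral>\<omega>. (\<Sum>t\<in>{1..T}. real (C a t \<omega>)) \<partial>M)
         - (\<integral>\<omega>. real (pulls_N C (klucb4p_A \<Theta> \<rho> Af F c K tau C X) a T \<omega>) \<partial>M)
       \<le> ctil a * (exp 1 * (2 * c + 3) * ln (ln (real T)) + real (cp a) + 3))"
proof -
  interpret exp_family \<Theta> \<rho> Af F by unfold_locales (rule assms)
  define Q where "Q \<epsilon> k m \<tau> p \<longleftrightarrow> 0 < fst p \<and> 0 < snd p \<and>
      (\<forall>(M :: 'w measure) K th tau cm cp ctil C X c a T.
         bandit_model M \<Theta> \<rho> Af F K th cm cp ctil C X T \<and> 0 < c \<and> a < K \<and> cm a = k \<and>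
         mean (th a) = m \<and> tau a = \<tau> \<and> m < \<tau> \<and> \<tau> \<in> mean ` \<Theta> \<and> 3 \<le> T \<longrightarrow>
         (\<integral>\<omega>. real (pulls_N C (klucb4p_A \<Theta> \<rho> Af F c K tau C X) a T \<omega>) \<partial>M)
           \<le> (1 + \<epsilon>) * ctil a * (ln (real T) + c * ln (ln (real T))) / (real k * expfam_kl \<Theta> \<rho> Af F m \<tau>)
             + ctil a * (1 + fst p / real T powr snd p))" for \<epsilon> k m \<tau> p
  \<comment> \<open>A choice function turns the pointwise existence of the pair into functions of
    \<epsilon>, the minimal group size and the two means.\<close>
  define p where "p \<epsilon> k m \<tau> = (SOME p. Q \<epsilon> k m \<tau> p)" for \<epsilon> k m \<tau>
  have p: "Q \<epsilon> k m \<tau> (p \<epsilon> k m \<tau>)" if pos: "0 < \<epsilon>" for \<epsilon> k m \<tau>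
  proof -
    have "\<exists>H \<beta>. Q \<epsilon> k m \<tau> (H, \<beta>)"
      unfolding Q_def fst_conv snd_conv by (rule unprofitable_arm[OF pos])
    then show ?thesis unfolding p_def by (blast intro: someI)
  qed
  show ?thesis
  proof (intro conjI exI allI impI)
    fix \<epsilon> m \<tau> :: real and cm :: nat
    assume "0 < \<epsilon> \<and> \<epsilon> < 1"
    then show "0 < fst (p \<epsilon> cm m \<tau>)" "0 < snd (p \<epsilon> cm m \<tau>)"
      using p[of \<epsilon> cm m \<tau>] unfolding Q_def by simp_all
  next
    fix M :: "'w measure" and K th tau cm cp ctil C X a T and c \<epsilon> :: real
    assume "bandit_model M \<Theta> \<rho> Af F K th cm cp ctil C X T \<and> 0 < c \<and> a < K \<and>
         mean (th a) < tau a \<and> tau a \<in> mean ` \<Theta> \<and> 0 < \<epsilon> \<and> \<epsilon> < 1 \<and> 3 \<le> T"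
    then show "(\<integral>\<omega>. real (pulls_N C (klucb4p_A \<Theta> \<rho> Af F c K tau C X) a T \<omega>) \<partial>M)
           \<le> (1 + \<epsilon>) * ctil a * (ln (real T) + c * ln (ln (real T)))
               / (real (cm a) * expfam_kl \<Theta> \<rho> Af F (mean (th a)) (tau a))
             + ctil a * (1 + fst (p \<epsilon> (cm a) (mean (th a)) (tau a))
                          / real T powr snd (p \<epsilon> (cm a) (mean (th a)) (tau a)))"
      using p[of \<epsilon> "cm a" "mean (th a)" "tau a"] unfolding Q_def by blast
  next
    fix M :: "'w measure" and K th tau cm cp ctil C X a T and c :: real
    assume "bandit_model M \<Theta> \<rho> Af F K th cm cp ctil C X T \<and> 3 \<le> c \<and> a < K \<and>
       tau a < mean (th a) \<and> 3 \<le> T \<and> cp a \<le> T"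
    then show "(\<integral>\<omega>. (\<Sum>t\<in>{1..T}. real (C a t \<omega>)) \<partial>M)
         - (\<integral>\<omega>. real (pulls_N C (klucb4p_A \<Theta> \<rho> Af F c K tau C X) a T \<omega>) \<partial>M)
       \<le> ctil a * (exp 1 * (2 * c + 3) * ln (ln (real T)) + real (cp a) + 3)"
      by (intro profitable_arm) auto
  qed
qed

end
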